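(* Let $0<q\leq 1$, $1\leq r\leq\infty$, $\varepsilon\geq 0$. Let $A\in\mathbb{R}^{m\times n}$, let $f\in\mathbb{R}^n$, and suppose we observe $y=Af+z$ with $z\in\mathbb{R}^m$, $\|z\|_r\leq\varepsilon$. Let $D\in\mathbb{R}^{n\times d}$ be a frame with frame bounds $0<\mathcal{L}\leq\mathcal{U}<\infty$. Fix positive integers $s,a$ with $s<a$, and set $\rho=s/a$, $\kappa=\mathcal{U}/\mathcal{L}$. Assume that the $(D^{\dagger},q)$-RIP constants of $A$ satisfy $$\rho^{1-q/2}\left(\rho^{2/q-1}+1\right)^{q/2}\kappa^q(1+\delta_a)<1-\delta_{s+a}.$$ Then any solution $\hat{f}$ of $$\min_{\tilde{f}\in\mathbb{R}^n}\|D^*\tilde{f}\|_q\quad\text{subject to}\quad\|A\tilde{f}-y\|_r\leq\varepsilon$$ satisfies $$\|\hat{f}-f\|_2\leq C_1\frac{\|D^*f-(D^*f)_{[s]}\|_q}{s^{1/q-1/2}}+C_2m^{1/q-1/r}\varepsilon$$ and $$\|D^*\hat{f}-D^*f\|_q^q\leq C_3\|D^*f-(D^*f)_{[s]}\|_q^q+C_4a^{1-q/2}m^{1-q/r}\varepsilon^q,$$ where $C_1,C_2,C_3,C_4$ are positive constants depending only on $\delta_a$, $\delta_{s+a}$, $\rho$, $q$, $\mathcal{L}$ and $\kappa$.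
   Context: $D\in\mathbb{R}^{n\times d}$ is a frame with frame bounds $0<\mathcal{L}\leq\mathcal{U}<\infty$ if $\mathcal{L}\|f\|_2^2\leq\|D^*f\|_2^2\leq\mathcal{U}\|f\|_2^2$ for all $f\in\mathbb{R}^n$. $D^{\dagger}=(DD^* )^{-1}D$ is the canonical dual frame. For a matrix $E\in\mathbb{R}^{n\times d}$, $A$ obeys the $(E,q)$-RIP of order $k$ with constant $\delta\in[0,1)$ if $(1-\delta)\|Ev\|_2^q\leq\|AEv\|_q^q\leq(1+\delta)\|Ev\|_2^q$ for all $v\in\mathbb{R}^d$ with at most $k$ nonzero entries; the $(E,q)$-RIP constant $\delta_k$ is the smallest such $\delta$. Here $\|u\|_q=(\sum_j|u_j|^q)^{1/q}$, $\|u\|_\infty=\max_j|u_j|$, and $x_{[s]}$ keeps the $s$ largest entries of $x$ in magnitude and zeros the rest. *)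

theory Defs
  imports "HOL-Analysis.Analysis" "HOL-Library.Extended_Real"
    "Jordan_Normal_Form.Gauss_Jordan_Elimination"
begin

definition lq_norm :: "real \<Rightarrow> real vec \<Rightarrow> real" where
  "lq_norm q u = (\<Sum>j<dim_vec u. \<bar>u $ j\<bar> powr q) powr (1 / q)"

definition l2_norm :: "real vec \<Rightarrow> real" where
  "l2_norm u = sqrt (\<Sum>j<dim_vec u. (u $ j)^2)"

definition linf_norm :: "real vec \<Rightarrow> real" where
  "linf_norm u = (if dim_vec u = 0 then 0 else Max ((\<lambda>j. \<bar>u $ j\<bar>) ` {..<dim_vec u}))"

definition lr_norm :: "ereal \<Rightarrow> real vec \<Rightarrow> real" where
  "lr_norm r u = (if r = \<infinity> then linf_norm u else lq_norm (real_of_ereal r) u)"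

definition recip_ereal :: "ereal \<Rightarrow> real" where
  "recip_ereal r = (if r = \<infinity> then 0 else 1 / real_of_ereal r)"

definition is_frame :: "real mat \<Rightarrow> real \<Rightarrow> real \<Rightarrow> bool" where
  "is_frame D L U \<longleftrightarrow> 0 < L \<and> L \<le> U \<and>
     (\<forall>f \<in> carrier_vec (dim_row D).
        L * (l2_norm f)^2 \<le> (l2_norm (transpose_mat D *\<^sub>v f))^2 \<and>
        (l2_norm (transpose_mat D *\<^sub>v f))^2 \<le> U * (l2_norm f)^2)"

definition canonical_dual :: "real mat \<Rightarrow> real mat" where
  "canonical_dual D = the (mat_inverse (D * transpose_mat D)) * D"

definition sparse_vec :: "nat \<Rightarrow> real vec \<Rightarrow> bool" where
  "sparse_vec k v \<longleftrightarrow> card {i. i < dim_vec v \<and> v $ i \<noteq> 0} \<le> k"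

definition has_Eq_RIP :: "real mat \<Rightarrow> real mat \<Rightarrow> real \<Rightarrow> nat \<Rightarrow> real \<Rightarrow> bool" where
  "has_Eq_RIP A E q k \<delta> \<longleftrightarrow> 0 \<le> \<delta> \<and> \<delta> < 1 \<and>
     (\<forall>v \<in> carrier_vec (dim_col E). sparse_vec k v \<longrightarrow>
        (1 - \<delta>) * (l2_norm (E *\<^sub>v v)) powr q \<le> (lq_norm q (A *\<^sub>v (E *\<^sub>v v))) powr q \<and>
        (lq_norm q (A *\<^sub>v (E *\<^sub>v v))) powr q \<le> (1 + \<delta>) * (l2_norm (E *\<^sub>v v)) powr q)"

definition is_Eq_RIP_const :: "real mat \<Rightarrow> real mat \<Rightarrow> real \<Rightarrow> nat \<Rightarrow> real \<Rightarrow> bool" where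
  "is_Eq_RIP_const A E q k \<delta> \<longleftrightarrow> has_Eq_RIP A E q k \<delta> \<and>
     (\<forall>\<delta>'. has_Eq_RIP A E q k \<delta>' \<longrightarrow> \<delta> \<le> \<delta>')"

text \<open>x_[s]: keep the s largest entries in magnitude (a choice among ties).\<close>
definition best_s_term :: "nat \<Rightarrow> real vec \<Rightarrow> real vec" where
  "best_s_term s x = (SOME y. \<exists>S. S \<subseteq> {..<dim_vec x} \<and> card S = min s (dim_vec x) \<and>
      (\<forall>i\<in>S. \<forall>j\<in>{..<dim_vec x} - S. \<bar>x $ j\<bar> \<le> \<bar>x $ i\<bar>) \<and>
      y = vec (dim_vec x) (\<lambda>i. if i \<in> S then x $ i else 0))"

definition is_lq_analysis_solution ::
  "real mat \<Rightarrow> real mat \<Rightarrow> real vec \<Rightarrow> real \<Rightarrow> ereal \<Rightarrow> real \<Rightarrow> real vec \<Rightarrow> bool" where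
  "is_lq_analysis_solution D A y q r \<epsilon> fh \<longleftrightarrow>
     fh \<in> carrier_vec (dim_col A) \<and> lr_norm r (A *\<^sub>v fh - y) \<le> \<epsilon> \<and>
     (\<forall>g \<in> carrier_vec (dim_col A). lr_norm r (A *\<^sub>v g - y) \<le> \<epsilon> \<longrightarrow>
        lq_norm q (transpose_mat D *\<^sub>v fh) \<le> lq_norm q (transpose_mat D *\<^sub>v g))"

end

theory Submission
  imports Defs "Jordan_Normal_Form.Determinant"
begin

text \<open>
  Put \<open>h = fh - f\<close>, \<open>v = D\<^sup>T h\<close>, and let \<open>S\<close> carry the \<open>s\<close> largest entries of \<open>D\<^sup>T f\<close>. Minimality
  of \<open>fh\<close> and the \<open>q\<close>-triangle inequality bound \<open>v\<close> off \<open>S\<close> by \<open>v\<close> on \<open>S\<close>. Cut the complement of \<open>S\<close>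
  into blocks of \<open>a\<close> entries of decreasing magnitude, let \<open>T\<close> be the first block, and write \<open>w\<close> for
  \<open>v\<close> restricted to \<open>S \<union> T\<close>, \<open>X\<close> for its norm and \<open>Y\<close> for the norm of the rest of \<open>v\<close>. With \<open>E\<close> the
  canonical dual frame, \<open>h = E v\<close>, so the two RIP inequalities bound \<open>|E w|\<^sup>q\<close> by a multiple of
  \<open>\<rho> powr (1 - q/2) * X\<^sup>q\<close> up to sparsity defect \<open>G\<close> and noise \<open>N\<close>. Since \<open>D\<^sup>T E\<close> is the orthogonal
  projection onto the range of \<open>D\<^sup>T\<close>, conversely \<open>X\<^sup>2 = w \<bullet> v \<le> \<surd>U |E w| \<surd>(X\<^sup>2 + Y\<^sup>2)\<close>.

  If \<open>G + N < t X\<^sup>q\<close>, these estimates are homogeneous in \<open>X\<close> and collapse to a numerical inequality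
  which at \<open>t = 0\<close> contradicts the hypothesis on the RIP constants (even with \<open>\<kappa> powr (q/2)\<close> in place of
  \<open>\<kappa> powr q\<close>). By continuity it still fails for some \<open>t > 0\<close> depending only on the parameters, whence
  \<open>X\<^sup>q \<le> (G + N) / t\<close>.
\<close>

section \<open>Power inequalities and block decompositions\<close>

text \<open>After division by \<open>a + b\<close> both summands lie in [0,1], where a number is at
  most its \<open>p\<close>-th power.\<close>

lemma powr_add_le_add_powr:
  fixes a b p :: real
  assumes "0 \<le> a" "0 \<le> b" "0 < p" "p \<le> 1"
  shows "(a + b) powr p \<le> a powr p + b powr p"
proof (cases "a + b = 0")
  case True
  then show ?thesis using assms by simp
next
  case False
  then have pos: "a + b > 0" using assms by linarith
  have le: "x / (a + b) \<le> (x / (a + b)) powr p" if "0 \<le> x" "x \<le> a + b" for x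
    using powr_mono'[of p 1 "x / (a + b)"] that pos assms by auto
  have "1 = a / (a + b) + b / (a + b)"
    using pos by (simp add: add_divide_distrib[symmetric])
  also have "\<dots> \<le> (a / (a + b)) powr p + (b / (a + b)) powr p"
    using le[of a] le[of b] assms by linarith
  also have "\<dots> = (a powr p + b powr p) / (a + b) powr p"
    using assms pos by (simp add: powr_divide add_divide_distrib)
  finally show ?thesis using pos by (simp add: field_simps)
qed

text \<open>Zero is included because vector entries may vanish. With an endpoint at 0, convexity
  reduces to \<open>u powr p \<le> u\<close> for \<open>u\<close> in (0,1).\<close>

lemma convex_on_powr_atLeast:
  fixes p :: real
  assumes p: "1 \<le> p"
  shows "convex_on {0..} (\<lambda>x. x powr p)"
proof (rule convex_onI)
  fix t x y :: real
  assume t: "0 < t" "t < 1" and xy: "x \<in> {0..}" "y \<in> {0..}"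
  have le: "(u * v) powr p \<le> u * v powr p" if "0 < u" "u < 1" "0 \<le> v" for u v :: real
    using powr_mono'[of 1 p u] that p by (simp add: powr_mult mult_right_mono)
  consider "x = 0" | "y = 0" | "x > 0" "y > 0" using xy by fastforce
  then show "((1 - t) *\<^sub>R x + t *\<^sub>R y) powr p \<le> (1 - t) * x powr p + t * y powr p"
  proof cases
    case 1
    then show ?thesis using le[of t y] t xy by simp
  next
    case 2
    then show ?thesis using le[of "1 - t" x] t xy by simp
  next
    case 3
    then show ?thesis using convex_onD[OF powr_convex[OF p], of t x y] t by simp
  qed
qed simp

text \<open>Jensen's inequality for the power \<open>r / p\<close> with uniform weights on
  \<open>S\<close>, applied to the numbers \<open>b i powr p\<close>. It serves to compare
  \<open>q\<close>-sums with Euclidean norms and with the \<open>r\<close>-norm of the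
  noise.\<close>

lemma sum_powr_power_mean:
  fixes b :: "'a \<Rightarrow> real"
  assumes S: "finite S" and b: "\<And>i. i \<in> S \<Longrightarrow> 0 \<le> b i" and pr: "0 < p" "p \<le> r"
  shows "(\<Sum>i\<in>S. b i powr p) \<le> real (card S) powr (1 - p / r) * (\<Sum>i\<in>S. b i powr r) powr (p / r)"
proof (cases "S = {}")
  case True
  then show ?thesis by simp
next
  case False
  define N where "N = real (card S)"
  have N: "N > 0" using False S by (simp add: N_def card_gt_0_iff)
  define k where "k = r / p"
  have k: "1 \<le> k" "0 < k" using pr by (auto simp: k_def)
  have conv: "convex_on {0..} (\<lambda>x::real. x powr k)" using convex_on_powr_atLeast k by simp
  have "(\<Sum>i\<in>S. (1 / N) *\<^sub>R (b i powr p)) powr k \<le> (\<Sum>i\<in>S. (1 / N) * (b i powr p) powr k)"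
    using False S N
    by (intro convex_on_sum[OF S False conv]) (auto simp: N_def)
  then have "((\<Sum>i\<in>S. b i powr p) / N) powr k \<le> (\<Sum>i\<in>S. b i powr r) / N"
    using pr by (simp add: powr_powr k_def sum_divide_distrib)
  then have "(((\<Sum>i\<in>S. b i powr p) / N) powr k) powr (1 / k) \<le> ((\<Sum>i\<in>S. b i powr r) / N) powr (1 / k)"
    using k by (intro powr_mono2) auto
  then have "(\<Sum>i\<in>S. b i powr p) / N \<le> ((\<Sum>i\<in>S. b i powr r) / N) powr (1 / k)"
    using k N by (simp add: powr_powr sum_nonneg)
  then have "(\<Sum>i\<in>S. b i powr p) \<le> N * ((\<Sum>i\<in>S. b i powr r) powr (1 / k) / N powr (1 / k))"
    using N by (simp add: powr_divide sum_nonneg field_simps)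
  also have "\<dots> = N powr (1 - 1 / k) * (\<Sum>i\<in>S. b i powr r) powr (1 / k)"
    using N by (simp add: powr_diff)
  finally show ?thesis by (simp add: N_def k_def)
qed

section \<open>Blocks of largest entries\<close>

lemma exists_top_subset:
  fixes w :: "'a \<Rightarrow> real"
  assumes "finite I" "k \<le> card I"
  shows "\<exists>T\<subseteq>I. card T = k \<and> (\<forall>i\<in>T. \<forall>j\<in>I - T. w j \<le> w i)"
  using assms(2)
proof (induction k)
  case 0
  show ?case by (intro exI[of _ "{}"]) auto
next
  case (Suc k)
  then obtain T where T: "T \<subseteq> I" "card T = k" "\<forall>i\<in>T. \<forall>j\<in>I - T. w j \<le> w i" by auto
  have fin: "finite (I - T)" "finite T" using assms(1) T(1) finite_subset by auto
  have ne: "I - T \<noteq> {}" using T Suc.prems fin by auto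
  have "Max (w ` (I - T)) \<in> w ` (I - T)" using fin ne by (intro Max_in) auto
  then obtain x where x: "x \<in> I - T" "w x = Max (w ` (I - T))" by auto
  have "w j \<le> w x" if "j \<in> I - T" for j using x(2) that fin by auto
  then show ?case using T x fin by (intro exI[of _ "insert x T"]) auto
qed

text \<open>The average \<open>M\<close> of \<open>w i powr q\<close> over \<open>T\<close>
  dominates \<open>w j powr q\<close> for every \<open>j\<close> in \<open>T'\<close>. The exponent
  \<open>q / 2 - 1\<close> combines \<open>q / 2\<close>, from counting at most \<open>a\<close>
  entries of \<open>T'\<close>, with -1, from averaging over \<open>T\<close>.\<close>

lemma block_powr_bound:
  fixes w :: "'a \<Rightarrow> real"
  assumes fin: "finite T" "finite T'" and cT: "card T = a" "card T' \<le> a" and a: "0 < a"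
    and q: "0 < q" and w: "\<And>i. 0 \<le> w i" and dom: "\<And>i j. i \<in> T \<Longrightarrow> j \<in> T' \<Longrightarrow> w j \<le> w i"
  shows "(\<Sum>i\<in>T'. (w i)\<^sup>2) powr (q / 2) \<le> real a powr (q / 2 - 1) * (\<Sum>i\<in>T. w i powr q)"
proof -
  define M where "M = (\<Sum>i\<in>T. w i powr q) / real a"
  have M0: "0 \<le> M" unfolding M_def by (simp add: sum_nonneg)
  have sq: "(w j)\<^sup>2 \<le> M powr (2 / q)" if j: "j \<in> T'" for j
  proof -
    have "real (card T) * (w j powr q) \<le> (\<Sum>i\<in>T. w i powr q)"
      using dom[OF _ j] w q by (intro sum_bounded_below) (auto intro!: powr_mono2)
    then have "w j powr q \<le> M" using cT a by (simp add: M_def field_simps)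
    then have "(w j powr q) powr (2 / q) \<le> M powr (2 / q)" using q by (intro powr_mono2) auto
    moreover have "(w j powr q) powr (2 / q) = (w j)\<^sup>2"
      using q w[of j] by (simp add: powr_powr)
    ultimately show ?thesis by simp
  qed
  have "(\<Sum>i\<in>T'. (w i)\<^sup>2) \<le> real (card T') * M powr (2 / q)"
    using sq by (intro sum_bounded_above) auto
  also have "\<dots> \<le> real a * M powr (2 / q)" using cT by (intro mult_right_mono) auto
  finally have "(\<Sum>i\<in>T'. (w i)\<^sup>2) powr (q / 2) \<le> (real a * M powr (2 / q)) powr (q / 2)"
    using q by (intro powr_mono2) (auto simp: sum_nonneg)
  also have "\<dots> = real a powr (q / 2) * M" using q M0 by (simp add: powr_mult powr_powr)
  also have "\<dots> = real a powr (q / 2 - 1) * (\<Sum>i\<in>T. w i powr q)"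
    using a by (simp add: M_def powr_diff)
  finally show ?thesis .
qed

text \<open>Peeling off successive blocks of \<open>a\<close> largest entries by induction avoids sorting: each block is
  charged to the preceding one.\<close>

lemma tail_block_bound:
  fixes w :: "'a \<Rightarrow> real" and \<Phi> :: "'a set \<Rightarrow> real"
  assumes "finite I" and a: "0 < a" and q: "0 < q" and c: "0 \<le> c" and w: "\<And>i. 0 \<le> w i"
    and sub: "\<And>P Q. P \<inter> Q = {} \<Longrightarrow> finite P \<Longrightarrow> finite Q \<Longrightarrow> \<Phi> (P \<union> Q) \<le> \<Phi> P + \<Phi> Q"
    and small: "\<And>P. finite P \<Longrightarrow> card P \<le> a \<Longrightarrow> \<Phi> P \<le> c * (\<Sum>i\<in>P. (w i)\<^sup>2) powr (q / 2)"
    and "T \<subseteq> I" "card T = min a (card I)" "\<And>i j. i \<in> T \<Longrightarrow> j \<in> I - T \<Longrightarrow> w j \<le> w i"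
  shows "\<Phi> (I - T) \<le> c * (real a powr (q / 2 - 1) * (\<Sum>i\<in>I. w i powr q))"
  using assms(1) assms(8-10)
proof (induction "card I" arbitrary: I T rule: less_induct)
  case less
  have finT: "finite T" by (rule finite_subset[OF less.prems(2,1)])
  define J where "J = I - T"
  have finJ: "finite J" using less.prems by (simp add: J_def)
  show ?case
  proof (cases "J = {}")
    case True
    have "0 \<le> c * (real a powr (q / 2 - 1) * (\<Sum>i\<in>I. w i powr q))"
      using c by (intro mult_nonneg_nonneg sum_nonneg) auto
    \<comment> \<open>On the empty set the bound contains \<open>0 powr (q / 2)\<close>, which is
      0.\<close>
    moreover have "\<Phi> {} \<le> 0" using small[of "{}"] by simp
    ultimately show ?thesis unfolding J_def[symmetric] True by linarith
  next
    case False
    have "card T < card I"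
      using False less.prems(1,2) by (intro psubset_card_mono) (auto simp: J_def)
    then have cT: "card T = a" using less.prems by simp
    have cJ: "card J < card I"
      using cT a less.prems(1,2) finT \<open>card T < card I\<close> by (simp add: J_def card_Diff_subset)
    obtain T' where T': "T' \<subseteq> J" "card T' = min a (card J)" "\<forall>i\<in>T'. \<forall>j\<in>J - T'. w j \<le> w i"
      using exists_top_subset[OF finJ, of "min a (card J)" w] by auto
    have finT': "finite T'" by (rule finite_subset[OF T'(1) finJ])
    have IH: "\<Phi> (J - T') \<le> c * (real a powr (q / 2 - 1) * (\<Sum>i\<in>J. w i powr q))"
      using less.hyps[OF cJ finJ T'(1,2)] T'(3) by auto
    have "\<Phi> T' \<le> c * (\<Sum>i\<in>T'. (w i)\<^sup>2) powr (q / 2)" using small finT' T' by auto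
    \<comment> \<open>\<open>T'\<close> is charged to its predecessor \<open>T\<close>, and by
      induction everything after \<open>T'\<close> is charged to \<open>J\<close>. As
      \<open>T\<close> and \<open>J\<close> partition \<open>I\<close>, no entry is charged
      twice.\<close>
    also have "\<dots> \<le> c * (real a powr (q / 2 - 1) * (\<Sum>i\<in>T. w i powr q))"
      using c finT finT' cT T' a q w less.prems(4)
      by (intro mult_left_mono block_powr_bound) (auto simp: J_def)
    finally have "\<Phi> (T' \<union> (J - T')) \<le> c * (real a powr (q / 2 - 1) * (\<Sum>i\<in>T. w i powr q))
       + c * (real a powr (q / 2 - 1) * (\<Sum>i\<in>J. w i powr q))"
      using sub[of T' "J - T'"] IH finT' finJ by force
    also have "\<dots> = c * (real a powr (q / 2 - 1) * ((\<Sum>i\<in>T. w i powr q) + (\<Sum>i\<in>J. w i powr q)))"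
      by (simp add: algebra_simps)
    also have "(\<Sum>i\<in>T. w i powr q) + (\<Sum>i\<in>J. w i powr q) = (\<Sum>i\<in>I. w i powr q)"
      unfolding J_def using sum.subset_diff[OF less.prems(2,1), of "\<lambda>i. w i powr q"] by simp
    finally show ?thesis using T' by (simp add: J_def Un_absorb1)
  qed
qed

section \<open>Frames and the canonical dual\<close>

lemma l2_norm_nonneg: "0 \<le> l2_norm u"
  by (simp add: l2_norm_def sum_nonneg)

lemma l2_norm_sq: "(l2_norm u)\<^sup>2 = (\<Sum>j<dim_vec u. (u $ j)\<^sup>2)"
  by (simp add: l2_norm_def sum_nonneg)

lemma l2_norm_sq_scalar_prod: "(l2_norm u)\<^sup>2 = scalar_prod u u"
  unfolding l2_norm_sq by (simp add: scalar_prod_def atLeast0LessThan power2_eq_square)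

lemma scalar_prod_le_l2_norm:
  assumes "dim_vec u = dim_vec v"
  shows "scalar_prod u v \<le> l2_norm u * l2_norm v"
proof -
  have "(scalar_prod u v)\<^sup>2 \<le> (l2_norm u * l2_norm v)\<^sup>2"
    using Cauchy_Schwarz_ineq_sum[of "\<lambda>j. u $ j" "\<lambda>j. v $ j" "{..<dim_vec v}"] assms
    by (simp add: scalar_prod_def atLeast0LessThan power_mult_distrib l2_norm_sq)
  then show ?thesis
    by (rule power2_le_imp_le) (simp add: l2_norm_nonneg)
qed

text \<open>The lower frame bound makes the Gram matrix injective, so its determinant is nonzero and
  \<open>mat_inverse\<close> succeeds; hence \<open>the\<close> in \<open>canonical_dual\<close>
  denotes a genuine inverse.\<close>

lemma canonical_dual_gram_inverse:
  assumes D: "D \<in> carrier_mat n d" and fr: "is_frame D L U"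
  obtains B where "B \<in> carrier_mat n n" "canonical_dual D = B * D"
    "B * (D * transpose_mat D) = 1\<^sub>m n" "(D * transpose_mat D) * B = 1\<^sub>m n"
proof -
  define G where "G = D * transpose_mat D"
  have G: "G \<in> carrier_mat n n" using D by (simp add: G_def)
  have inj: "u = 0\<^sub>v n" if u: "u \<in> carrier_vec n" "G *\<^sub>v u = 0\<^sub>v n" for u
  proof -
    have "(l2_norm (transpose_mat D *\<^sub>v u))\<^sup>2 = scalar_prod u (D *\<^sub>v (transpose_mat D *\<^sub>v u))"
      unfolding l2_norm_sq_scalar_prod
      using transpose_vec_mult_scalar[OF D _ u(1), of "transpose_mat D *\<^sub>v u"] D u by simp
    also have "D *\<^sub>v (transpose_mat D *\<^sub>v u) = 0\<^sub>v n"
      using u D assoc_mult_mat_vec[of D n d "transpose_mat D" n u] by (simp add: G_def)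
    finally have z: "(l2_norm (transpose_mat D *\<^sub>v u))\<^sup>2 = 0" using u by simp
    have "L * (l2_norm u)\<^sup>2 \<le> (l2_norm (transpose_mat D *\<^sub>v u))\<^sup>2" "0 < L"
      using fr D u by (auto simp: is_frame_def)
    then have "(l2_norm u)\<^sup>2 \<le> 0" using z by (simp add: mult_le_0_iff)
    then have "(\<Sum>j<dim_vec u. (u $ j)\<^sup>2) = 0"
      using l2_norm_sq[of u] by (simp add: sum_nonneg order_antisym)
    then have "\<forall>j<dim_vec u. u $ j = 0" by (simp add: sum_nonneg_eq_0_iff)
    then show ?thesis using u by (intro eq_vecI) auto
  qed
  have "Determinant.det G \<noteq> 0" using det_0_iff_vec_prod_zero_field[OF G] inj by blast
  then have "G \<in> Units (ring_mat TYPE(real) n ())" by (rule det_non_zero_imp_unit[OF G])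
  then obtain B where B: "mat_inverse G = Some B"
    using mat_inverse(1)[OF G, where b = "()"] by (cases "mat_inverse G") auto
  show ?thesis
    using that[of B] mat_inverse(2)[OF G B] B
    by (simp add: canonical_dual_def G_def)
qed

lemma canonical_dual_carrier:
  assumes "D \<in> carrier_mat n d" "is_frame D L U"
  shows "canonical_dual D \<in> carrier_mat n d"
proof -
  obtain B where "B \<in> carrier_mat n n" "canonical_dual D = B * D"
    using canonical_dual_gram_inverse[OF assms] .
  then show ?thesis using assms(1) by simp
qed

lemma canonical_dual_reconstruct:
  assumes D: "D \<in> carrier_mat n d" and fr: "is_frame D L U" and g: "g \<in> carrier_vec n"
  shows "canonical_dual D *\<^sub>v (transpose_mat D *\<^sub>v g) = g"
proof -
  obtain B where B: "B \<in> carrier_mat n n" "canonical_dual D = B * D"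
    "B * (D * transpose_mat D) = 1\<^sub>m n"
    using canonical_dual_gram_inverse[OF D fr] .
  have DT: "transpose_mat D \<in> carrier_mat d n" using D by simp
  have "canonical_dual D *\<^sub>v (transpose_mat D *\<^sub>v g) = (B * D * transpose_mat D) *\<^sub>v g"
    unfolding B(2) using assoc_mult_mat_vec[OF mult_carrier_mat[OF B(1) D] DT g] by (rule sym)
  also have "B * D * transpose_mat D = 1\<^sub>m n"
    using assoc_mult_mat[OF B(1) D DT] B(3) by simp
  finally show ?thesis using g by simp
qed

text \<open>With \<open>E\<close> the canonical dual, this places \<open>w - D\<^sup>T E w\<close>
  in the kernel of \<open>D\<close>, the orthogonal complement of the range of
  \<open>D\<^sup>T\<close>. So \<open>D\<^sup>T E w\<close> is the orthogonal projection of
  \<open>w\<close> onto that range.\<close>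

lemma frame_synthesis_canonical_dual:
  assumes D: "D \<in> carrier_mat n d" and fr: "is_frame D L U" and w: "w \<in> carrier_vec d"
  shows "D *\<^sub>v (transpose_mat D *\<^sub>v (canonical_dual D *\<^sub>v w)) = D *\<^sub>v w"
proof -
  obtain B where B: "B \<in> carrier_mat n n" "canonical_dual D = B * D"
    "(D * transpose_mat D) * B = 1\<^sub>m n"
    using canonical_dual_gram_inverse[OF D fr] .
  have DT: "transpose_mat D \<in> carrier_mat d n" using D by simp
  have Dw: "D *\<^sub>v w \<in> carrier_vec n" using D w by simp
  have BDw: "B *\<^sub>v (D *\<^sub>v w) \<in> carrier_vec n" using B Dw by simp
  have DDT: "D * transpose_mat D \<in> carrier_mat n n" using D by simp
  have "D *\<^sub>v (transpose_mat D *\<^sub>v (canonical_dual D *\<^sub>v w))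
      = (D * transpose_mat D) *\<^sub>v (B *\<^sub>v (D *\<^sub>v w))"
    unfolding B(2) assoc_mult_mat_vec[OF B(1) D w] assoc_mult_mat_vec[OF D DT BDw] ..
  also have "\<dots> = (D * transpose_mat D * B) *\<^sub>v (D *\<^sub>v w)"
    using assoc_mult_mat_vec[OF DDT B(1) Dw] by simp
  finally show ?thesis using B(3) Dw by simp
qed

text \<open>A vector and its projection onto the range of \<open>D\<^sup>T\<close> have the same
  inner product with \<open>D\<^sup>T g\<close>; then Cauchy-Schwarz applies to the projection,
  whose norm is controlled by that of \<open>E w\<close>.\<close>

lemma scalar_prod_analysis_le:
  assumes D: "D \<in> carrier_mat n d" and fr: "is_frame D L U"
    and w: "w \<in> carrier_vec d" and g: "g \<in> carrier_vec n"
  shows "scalar_prod w (transpose_mat D *\<^sub>v g)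
    \<le> l2_norm (transpose_mat D *\<^sub>v (canonical_dual D *\<^sub>v w)) * l2_norm (transpose_mat D *\<^sub>v g)"
proof -
  let ?E = "canonical_dual D" and ?T = "transpose_mat D"
  have E: "?E *\<^sub>v w \<in> carrier_vec n"
    using canonical_dual_carrier[OF D fr] w by simp
  have TE: "?T *\<^sub>v (?E *\<^sub>v w) \<in> carrier_vec d" and Tg: "?T *\<^sub>v g \<in> carrier_vec d"
    using D E g by auto
  have adj: "scalar_prod u (?T *\<^sub>v g) = scalar_prod g (D *\<^sub>v u)" if "u \<in> carrier_vec d" for u
    using transpose_vec_mult_scalar[OF D that g] comm_scalar_prod[OF that Tg] by simp
  have "scalar_prod w (?T *\<^sub>v g) = scalar_prod (?T *\<^sub>v (?E *\<^sub>v w)) (?T *\<^sub>v g)"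
    using adj[OF w] adj[OF TE] frame_synthesis_canonical_dual[OF D fr w] by simp
  also have "\<dots> \<le> l2_norm (?T *\<^sub>v (?E *\<^sub>v w)) * l2_norm (?T *\<^sub>v g)"
    using D by (intro scalar_prod_le_l2_norm) simp
  finally show ?thesis .
qed

lemma frame_bounds_sqrt:
  assumes D: "D \<in> carrier_mat n d" and fr: "is_frame D L U" and g: "g \<in> carrier_vec n"
  shows "sqrt L * l2_norm g \<le> l2_norm (transpose_mat D *\<^sub>v g)"
    and "l2_norm (transpose_mat D *\<^sub>v g) \<le> sqrt U * l2_norm g"
proof -
  have b: "L * (l2_norm g)\<^sup>2 \<le> (l2_norm (transpose_mat D *\<^sub>v g))\<^sup>2"
    "(l2_norm (transpose_mat D *\<^sub>v g))\<^sup>2 \<le> U * (l2_norm g)\<^sup>2" "0 < L" "0 < U"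
    using fr D g by (auto simp: is_frame_def)
  show "sqrt L * l2_norm g \<le> l2_norm (transpose_mat D *\<^sub>v g)"
  proof (rule power2_le_imp_le)
    show "(sqrt L * l2_norm g)\<^sup>2 \<le> (l2_norm (transpose_mat D *\<^sub>v g))\<^sup>2"
      using b(1,3) by (simp add: power_mult_distrib)
  qed (rule l2_norm_nonneg)
  show "l2_norm (transpose_mat D *\<^sub>v g) \<le> sqrt U * l2_norm g"
  proof (rule power2_le_imp_le)
    show "(l2_norm (transpose_mat D *\<^sub>v g))\<^sup>2 \<le> (sqrt U * l2_norm g)\<^sup>2"
      using b(2,4) by (simp add: power_mult_distrib)
    show "0 \<le> sqrt U * l2_norm g" using b(4) l2_norm_nonneg[of g] by simp
  qed
qed

text \<open>The projection \<open>D\<^sup>T E w\<close> is no longer than \<open>w\<close>, and the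
  lower frame bound transfers this to \<open>E w\<close>.\<close>

lemma canonical_dual_bound:
  assumes D: "D \<in> carrier_mat n d" and fr: "is_frame D L U" and w: "w \<in> carrier_vec d"
  shows "sqrt L * l2_norm (canonical_dual D *\<^sub>v w) \<le> l2_norm w"
proof -
  let ?g = "canonical_dual D *\<^sub>v w" and ?T = "transpose_mat D"
  have g: "?g \<in> carrier_vec n"
    using canonical_dual_carrier[OF D fr] w by simp
  have Tg: "?T *\<^sub>v ?g \<in> carrier_vec d" using D g by simp
  have "(l2_norm (?T *\<^sub>v ?g))\<^sup>2 = scalar_prod ?g (D *\<^sub>v (?T *\<^sub>v ?g))"
    unfolding l2_norm_sq_scalar_prod using transpose_vec_mult_scalar[OF D Tg g] .
  also have "\<dots> = scalar_prod (?T *\<^sub>v ?g) w"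
    unfolding frame_synthesis_canonical_dual[OF D fr w]
    using transpose_vec_mult_scalar[OF D w g] by simp
  also have "\<dots> \<le> l2_norm (?T *\<^sub>v ?g) * l2_norm w"
    using D w by (intro scalar_prod_le_l2_norm) simp
  finally have "l2_norm (?T *\<^sub>v ?g) \<le> l2_norm w"
    using l2_norm_nonneg[of "?T *\<^sub>v ?g"] l2_norm_nonneg[of w]
    by (cases "l2_norm (?T *\<^sub>v ?g) = 0") (auto simp: power2_eq_square)
  then show ?thesis using frame_bounds_sqrt(1)[OF D fr g] by linarith
qed

section \<open>Restriction of vectors to index sets\<close>

definition restrict_vec :: "'a :: zero vec \<Rightarrow> nat set \<Rightarrow> 'a vec" where
  "restrict_vec v T = vec (dim_vec v) (\<lambda>i. if i \<in> T then v $ i else 0)"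

lemma dim_restrict_vec [simp]: "dim_vec (restrict_vec v T) = dim_vec v"
  by (simp add: restrict_vec_def)

lemma restrict_vec_carrier [simp]: "v \<in> carrier_vec d \<Longrightarrow> restrict_vec v T \<in> carrier_vec d"
  by (simp add: restrict_vec_def)

lemma index_restrict_vec [simp]:
  "i < dim_vec v \<Longrightarrow> restrict_vec v T $ i = (if i \<in> T then v $ i else 0)"
  by (simp add: restrict_vec_def)

lemma restrict_vec_Un:
  fixes v :: "'a :: monoid_add vec"
  assumes "P \<inter> Q = {}"
  shows "restrict_vec v (P \<union> Q) = restrict_vec v P + restrict_vec v Q"
  using assms by (intro eq_vecI) auto

lemma sparse_restrict_vec:
  assumes "finite T" "card T \<le> k"
  shows "sparse_vec k (restrict_vec v T)"
proof -
  have "card {i. i < dim_vec (restrict_vec v T) \<and> restrict_vec v T $ i \<noteq> 0} \<le> card T"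
    using assms by (intro card_mono) (auto split: if_splits)
  then show ?thesis using assms by (simp add: sparse_vec_def)
qed

lemma l2_norm_sq_restrict_vec:
  "(l2_norm (restrict_vec v T))\<^sup>2 = (\<Sum>i\<in>{..<dim_vec v} \<inter> T. (v $ i)\<^sup>2)"
proof -
  have "(l2_norm (restrict_vec v T))\<^sup>2 = (\<Sum>i<dim_vec v. if i \<in> T then (v $ i)\<^sup>2 else 0)"
    unfolding l2_norm_sq dim_restrict_vec by (intro sum.cong) auto
  then show ?thesis by (simp add: sum.inter_restrict)
qed

lemma scalar_prod_restrict_vec:
  fixes v :: "real vec"
  shows "scalar_prod (restrict_vec v T) v = (l2_norm (restrict_vec v T))\<^sup>2"
  unfolding l2_norm_sq_scalar_prod scalar_prod_def
  by (intro sum.cong) auto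

section \<open>Quasinorms\<close>

lemma lq_norm_powr:
  assumes "0 < q"
  shows "lq_norm q u powr q = (\<Sum>j<dim_vec u. \<bar>u $ j\<bar> powr q)"
  using assms by (simp add: lq_norm_def powr_powr sum_nonneg)

lemma abs_powr_triangle:
  fixes a b :: real
  assumes "0 < q" "q \<le> 1"
  shows "\<bar>a + b\<bar> powr q \<le> \<bar>a\<bar> powr q + \<bar>b\<bar> powr q"
proof -
  have "\<bar>a + b\<bar> powr q \<le> (\<bar>a\<bar> + \<bar>b\<bar>) powr q" using assms by (intro powr_mono2) auto
  also have "\<dots> \<le> \<bar>a\<bar> powr q + \<bar>b\<bar> powr q"
    using assms by (intro powr_add_le_add_powr) auto
  finally show ?thesis .
qed

text \<open>For \<open>q < 1\<close> the triangle inequality with constant 1 holds for the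
  \<open>q\<close>-th power and not for \<open>lq_norm\<close> itself, so the error estimates work
  with powers and take the root last.\<close>

lemma lq_norm_powr_add:
  assumes q: "0 < q" "q \<le> 1" and "dim_vec u = dim_vec w"
  shows "lq_norm q (u + w) powr q \<le> lq_norm q u powr q + lq_norm q w powr q"
proof -
  have "(\<Sum>j<dim_vec w. \<bar>u $ j + w $ j\<bar> powr q) \<le> (\<Sum>j<dim_vec w. \<bar>u $ j\<bar> powr q + \<bar>w $ j\<bar> powr q)"
    by (intro sum_mono abs_powr_triangle[OF q])
  then show ?thesis using assms by (simp add: lq_norm_powr sum.distrib)
qed

lemma lq_norm_powr_diff:
  assumes q: "0 < q" "q \<le> 1" and "dim_vec u = dim_vec w"
  shows "lq_norm q (u - w) powr q \<le> lq_norm q u powr q + lq_norm q w powr q"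
proof -
  have "\<bar>a - b\<bar> powr q \<le> \<bar>a\<bar> powr q + \<bar>b\<bar> powr q" for a b :: real
    using abs_powr_triangle[OF q, of a "- b"] by simp
  then have "(\<Sum>j<dim_vec w. \<bar>u $ j - w $ j\<bar> powr q) \<le> (\<Sum>j<dim_vec w. \<bar>u $ j\<bar> powr q + \<bar>w $ j\<bar> powr q)"
    by (intro sum_mono)
  then show ?thesis using assms by (simp add: lq_norm_powr sum.distrib)
qed

text \<open>For finite \<open>r\<close> this is the power mean inequality with exponents
  \<open>q \<le> r\<close>; for infinite \<open>r\<close> each of the \<open>m\<close> entries is at
  most \<epsilon>. \<open>recip_ereal\<close> gives both cases the same exponent.\<close>

lemma lq_norm_powr_le_lr_norm:
  assumes q: "0 < q" "q \<le> 1" and r: "1 \<le> r" and u: "u \<in> carrier_vec m"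
    and le: "lr_norm r u \<le> \<epsilon>" and e: "0 \<le> \<epsilon>"
  shows "lq_norm q u powr q \<le> real m powr (1 - q * recip_ereal r) * \<epsilon> powr q"
proof (cases "r = \<infinity>")
  case True
  have "\<bar>u $ j\<bar> \<le> \<epsilon>" if "j < m" for j
  proof -
    have "\<bar>u $ j\<bar> \<le> Max ((\<lambda>j. \<bar>u $ j\<bar>) ` {..<m})" using that by (intro Max_ge) auto
    moreover have "lr_norm r u = Max ((\<lambda>j. \<bar>u $ j\<bar>) ` {..<m})"
      using u True that by (simp add: lr_norm_def linf_norm_def)
    ultimately show ?thesis using le by linarith
  qed
  then have "(\<Sum>j<m. \<bar>u $ j\<bar> powr q) \<le> (\<Sum>j<m. \<epsilon> powr q)"
    using q by (intro sum_mono powr_mono2) auto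
  then show ?thesis using True u q by (simp add: lq_norm_powr recip_ereal_def)
next
  case False
  then obtain p where p: "r = ereal p" "1 \<le> p" using r by (cases r) auto
  have "(\<Sum>j<m. \<bar>u $ j\<bar> powr q) \<le> real (card {..<m}) powr (1 - q / p) * (\<Sum>j<m. \<bar>u $ j\<bar> powr p) powr (q / p)"
    using q p by (intro sum_powr_power_mean) auto
  also have "(\<Sum>j<m. \<bar>u $ j\<bar> powr p) powr (q / p) = lq_norm p u powr q"
    using u by (simp add: lq_norm_def powr_powr)
  also have "lq_norm p u powr q \<le> \<epsilon> powr q"
    using le q False p by (intro powr_mono2) (auto simp: lr_norm_def lq_norm_def)
  finally show ?thesis using u q p by (simp add: lq_norm_powr recip_ereal_def mult_left_mono)
qed

text \<open>A top subset exists, so the choice in \<open>best_s_term\<close> has its defining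
  property.\<close>

lemma best_s_term_restrict:
  obtains S where "S \<subseteq> {..<dim_vec x}" "card S \<le> s" "best_s_term s x = restrict_vec x S"
proof -
  let ?top = "\<lambda>y S. S \<subseteq> {..<dim_vec x} \<and> card S = min s (dim_vec x) \<and>
      (\<forall>i\<in>S. \<forall>j\<in>{..<dim_vec x} - S. \<bar>x $ j\<bar> \<le> \<bar>x $ i\<bar>) \<and>
      y = vec (dim_vec x) (\<lambda>i. if i \<in> S then x $ i else 0)"
  have "\<exists>y S. ?top y S"
    using exists_top_subset[of "{..<dim_vec x}" "min s (dim_vec x)" "\<lambda>i. \<bar>x $ i\<bar>"] by auto
  then have "\<exists>S. ?top (best_s_term s x) S"
    unfolding best_s_term_def by (rule someI_ex)
  then obtain S where "?top (best_s_term s x) S" ..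
  then show ?thesis by (intro that[of S]) (simp_all add: restrict_vec_def)
qed

lemma lq_norm_powr_diff_restrict_vec:
  fixes x :: "real vec"
  assumes "0 < q" "S \<subseteq> {..<dim_vec x}"
  shows "lq_norm q (x - restrict_vec x S) powr q = (\<Sum>i\<in>{..<dim_vec x} - S. \<bar>x $ i\<bar> powr q)"
proof -
  have "lq_norm q (x - restrict_vec x S) powr q
      = (\<Sum>i<dim_vec x. if i \<in> - S then \<bar>x $ i\<bar> powr q else 0)"
    using assms by (simp add: lq_norm_powr) (intro sum.cong, auto)
  also have "\<dots> = (\<Sum>i\<in>{..<dim_vec x} \<inter> - S. \<bar>x $ i\<bar> powr q)"
    by (simp add: sum.inter_restrict)
  finally show ?thesis by (simp add: Diff_eq)
qed

text \<open>The reverse triangle inequality is used in opposite directions: on \<open>S\<close> the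
  entry \<open>x i\<close> is kept and \<open>v i\<close> subtracted, off \<open>S\<close> the other
  way round. The tail of \<open>x\<close> is paid once there and once in the right side of
  \<open>le\<close>, hence the factor 2.\<close>

lemma cone_constraint:
  fixes x v :: "'a \<Rightarrow> real"
  assumes q: "0 < q" "q \<le> 1" and I: "finite I" "S \<subseteq> I"
    and le: "(\<Sum>i\<in>I. \<bar>x i + v i\<bar> powr q) \<le> (\<Sum>i\<in>I. \<bar>x i\<bar> powr q)"
  shows "(\<Sum>i\<in>I - S. \<bar>v i\<bar> powr q) \<le> (\<Sum>i\<in>S. \<bar>v i\<bar> powr q) + 2 * (\<Sum>i\<in>I - S. \<bar>x i\<bar> powr q)"
proof -
  have split: "(\<Sum>i\<in>I. g i) = (\<Sum>i\<in>I - S. g i) + (\<Sum>i\<in>S. g i)" for g :: "'a \<Rightarrow> real"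
    using sum.subset_diff[OF I(2,1)] .
  have on: "\<bar>a\<bar> powr q - \<bar>b\<bar> powr q \<le> \<bar>a + b\<bar> powr q" for a b :: real
    using abs_powr_triangle[OF q, of "a + b" "- b"] by simp
  have off: "\<bar>b\<bar> powr q - \<bar>a\<bar> powr q \<le> \<bar>a + b\<bar> powr q" for a b :: real
    using on[of b a] by (simp add: add.commute)
  have "(\<Sum>i\<in>I - S. \<bar>v i\<bar> powr q - \<bar>x i\<bar> powr q) + (\<Sum>i\<in>S. \<bar>x i\<bar> powr q - \<bar>v i\<bar> powr q)
      \<le> (\<Sum>i\<in>I. \<bar>x i + v i\<bar> powr q)"
    unfolding split[of "\<lambda>i. \<bar>x i + v i\<bar> powr q"] by (intro add_mono sum_mono on off)
  then show ?thesis using le split[of "\<lambda>i. \<bar>x i\<bar> powr q"] by (simp add: sum_subtractf)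
qed

section \<open>The error of analysis minimizers\<close>

text \<open>The strict inequality that the parameters satisfy at \<open>t = 0\<close>, relaxed by a slack \<open>t > 0\<close> that
  absorbs sparsity defect and noise.\<close>

definition rip_slack_ok :: "real \<Rightarrow> real \<Rightarrow> real \<Rightarrow> real \<Rightarrow> real \<Rightarrow> real \<Rightarrow> real \<Rightarrow> bool" where
  "rip_slack_ok \<delta>a \<delta>s \<rho> q L \<kappa> t \<longleftrightarrow> 0 < t \<and>
    (\<kappa> * L) powr (q / 2) * (1 + (\<rho> powr (1 - q / 2) + t) powr (2 / q)) powr (q / 2)
      * ((1 + \<delta>a) * L powr (- q / 2) * (\<rho> powr (1 - q / 2) + t) + t) < 1 - \<delta>s"

text \<open>The left side is continuous in \<open>t\<close>. At \<open>t = 0\<close> the powers of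
  \<open>L\<close> cancel, and since \<open>1 \<le> \<kappa>\<close> the value is at most the left
  side of \<open>cond\<close>; the strict inequality therefore persists for some positive
  \<open>t\<close>.\<close>

lemma rip_slack_ok_exists:
  assumes q: "0 < q" and \<rho>: "0 < \<rho>" and L: "0 < L" and \<kappa>: "1 \<le> \<kappa>" and d: "0 \<le> \<delta>a"
    and cond: "\<rho> powr (1 - q / 2) * (\<rho> powr (2 / q - 1) + 1) powr (q / 2) * \<kappa> powr q * (1 + \<delta>a) < 1 - \<delta>s"
  shows "\<exists>t. rip_slack_ok \<delta>a \<delta>s \<rho> q L \<kappa> t"
proof -
  define \<alpha> where "\<alpha> = \<rho> powr (1 - q / 2)"
  have \<alpha>: "\<alpha> > 0" using \<rho> by (simp add: \<alpha>_def)
  define F where "F = (\<lambda>t. (\<kappa> * L) powr (q / 2) * (1 + (\<alpha> + t) powr (2 / q)) powr (q / 2)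
      * ((1 + \<delta>a) * L powr (- q / 2) * (\<alpha> + t) + t))"
  have "\<alpha> powr (2 / q) = \<rho> powr (2 / q - 1)"
    using q by (simp add: \<alpha>_def powr_powr algebra_simps)
  then have "F 0 = \<kappa> powr (q / 2) * (L powr (q / 2) * L powr (- q / 2))
      * (1 + \<rho> powr (2 / q - 1)) powr (q / 2) * (1 + \<delta>a) * \<alpha>"
    using \<kappa> L by (simp add: F_def powr_mult)
  also have "L powr (q / 2) * L powr (- q / 2) = 1"
    using L by (simp flip: powr_add)
  also have "\<kappa> powr (q / 2) * 1 * (1 + \<rho> powr (2 / q - 1)) powr (q / 2) * (1 + \<delta>a) * \<alpha>
     \<le> \<kappa> powr q * 1 * (1 + \<rho> powr (2 / q - 1)) powr (q / 2) * (1 + \<delta>a) * \<alpha>"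
    using \<kappa> q d \<alpha> by (intro mult_right_mono powr_mono) auto
  also have "\<dots> < 1 - \<delta>s" using cond by (simp add: \<alpha>_def algebra_simps)
  finally have F0: "F 0 < 1 - \<delta>s" .
  have "isCont F 0" unfolding F_def using \<alpha> q
    by (intro continuous_intros) (auto simp: add_nonneg_eq_0_iff)
  then have "F \<midarrow>0\<rightarrow> F 0" by (simp add: isCont_def)
  then have "(F \<longlongrightarrow> F 0) (at_right 0)" by (rule filterlim_mono) (auto simp: at_le)
  then have "\<forall>\<^sub>F t in at_right 0. F t < 1 - \<delta>s" using F0 by (rule order_tendstoD)
  with eventually_at_right_less[of "0::real"]
  have "\<forall>\<^sub>F t in at_right 0. 0 < t \<and> F t < 1 - \<delta>s" by (rule eventually_conj)
  from eventually_happens'[OF trivial_limit_at_right_real this]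
  obtain t where "0 < t" "F t < 1 - \<delta>s" by blast
  then show ?thesis by (auto simp: rip_slack_ok_def F_def \<alpha>_def)
qed

text \<open>Negating the claim bounds \<open>G\<close> and \<open>N\<close> by multiples of
  \<open>P = X powr q\<close>. Then \<open>rip\<close> bounds \<open>e powr q\<close> by a multiple
  of \<open>P\<close>, while \<open>XW\<close> and \<open>Y\<close> bound \<open>P\<close> by a
  multiple of \<open>e powr q\<close>; \<open>ok\<close> makes the two constants
  incompatible.\<close>

lemma rip_slack_bound:
  assumes ok: "rip_slack_ok \<delta>a \<delta>s \<rho> q L \<kappa> t"
    and q: "0 < q" and \<rho>: "0 < \<rho>" and L: "0 < L" and \<kappa>: "1 \<le> \<kappa>" and d: "0 \<le> \<delta>a" "\<delta>s < 1"
    and nn: "0 \<le> X" "0 \<le> Y" "0 \<le> G" "0 \<le> N" "0 \<le> e"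
    and rip: "(1 - \<delta>s) * e powr q \<le>
      (1 + \<delta>a) * L powr (- q / 2) * (\<rho> powr (1 - q / 2) * X powr q + G) + N"
    and XW: "X\<^sup>2 \<le> sqrt (\<kappa> * L) * e * sqrt (X\<^sup>2 + Y\<^sup>2)"
    and Y: "Y powr q \<le> \<rho> powr (1 - q / 2) * X powr q + G"
  shows "t * X powr q \<le> G + N"
proof (rule ccontr)
  assume neg: "\<not> ?thesis"
  define \<alpha> where "\<alpha> = \<rho> powr (1 - q / 2)"
  have \<alpha>: "\<alpha> > 0" using \<rho> by (simp add: \<alpha>_def)
  have t: "t > 0" using ok by (simp add: rip_slack_ok_def)
  define P where "P = X powr q"
  have GN: "G + N < t * P" using neg by (simp add: P_def)
  then have "P \<noteq> 0" using nn by auto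
  then have X: "X > 0" using nn by (auto simp: P_def)
  have P: "P > 0" using X by (simp add: P_def)
  define b where "b = (1 + \<delta>a) * L powr (- q / 2)"
  have b: "b \<ge> 0" using d by (simp add: b_def)
  define R where "R = 1 + (\<alpha> + t) powr (2 / q)"
  have R: "R > 0" by (simp add: R_def add_pos_nonneg)
  have "(1 - \<delta>s) * e powr q \<le> b * (\<alpha> * P + G) + N"
    using rip by (simp add: b_def \<alpha>_def P_def)
  \<comment> \<open>Both \<open>G\<close> and \<open>N\<close> are nonnegative, so each lies below
    \<open>t * P\<close>.\<close>
  also have "\<dots> \<le> b * (\<alpha> * P + t * P) + t * P"
    using GN nn b \<alpha> by (intro add_mono mult_left_mono) auto
  also have "\<dots> = (b * (\<alpha> + t) + t) * P" by (simp add: algebra_simps)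
  finally have e1: "(1 - \<delta>s) * e powr q \<le> (b * (\<alpha> + t) + t) * P" .
  have "Y powr q \<le> (\<alpha> + t) * P" using Y GN nn by (simp add: \<alpha>_def P_def algebra_simps)
  then have "(Y powr q) powr (2 / q) \<le> ((\<alpha> + t) * P) powr (2 / q)"
    using q by (intro powr_mono2) auto
  moreover have "(Y powr q) powr (2 / q) = Y\<^sup>2" using q nn by (simp add: powr_powr)
  moreover have "((\<alpha> + t) * P) powr (2 / q) = (\<alpha> + t) powr (2 / q) * X\<^sup>2"
    using q X \<alpha> t by (simp add: powr_mult P_def powr_powr)
  ultimately have "X\<^sup>2 + Y\<^sup>2 \<le> R * X\<^sup>2" by (simp add: R_def algebra_simps)
  then have "sqrt (X\<^sup>2 + Y\<^sup>2) \<le> sqrt R * X"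
    using X by (metis real_sqrt_le_iff real_sqrt_mult real_sqrt_unique less_eq_real_def)
  then have "sqrt (\<kappa> * L) * e * sqrt (X\<^sup>2 + Y\<^sup>2) \<le> sqrt (\<kappa> * L) * e * (sqrt R * X)"
    using nn \<kappa> L by (intro mult_left_mono) auto
  then have "X * X \<le> (sqrt (\<kappa> * L) * e * sqrt R) * X"
    using XW by (simp add: power2_eq_square algebra_simps)
  then have "X \<le> sqrt (\<kappa> * L) * e * sqrt R" using X by simp
  then have "P \<le> (sqrt (\<kappa> * L) * e * sqrt R) powr q"
    unfolding P_def using q X by (intro powr_mono2) auto
  also have "\<dots> = (\<kappa> * L) powr (q / 2) * R powr (q / 2) * e powr q"
    using \<kappa> L R nn by (simp add: powr_mult powr_powr powr_half_sqrt[symmetric])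
  finally have "(1 - \<delta>s) * P \<le> (1 - \<delta>s) * ((\<kappa> * L) powr (q / 2) * R powr (q / 2) * e powr q)"
    using d by (intro mult_left_mono) auto
  also have "\<dots> = (\<kappa> * L) powr (q / 2) * R powr (q / 2) * ((1 - \<delta>s) * e powr q)"
    by (simp add: algebra_simps)
  also have "\<dots> \<le> (\<kappa> * L) powr (q / 2) * R powr (q / 2) * ((b * (\<alpha> + t) + t) * P)"
    using e1 by (intro mult_left_mono) auto
  also have "\<dots> = ((\<kappa> * L) powr (q / 2) * R powr (q / 2) * (b * (\<alpha> + t) + t)) * P" by simp
  \<comment> \<open>The factor of \<open>P\<close> is exactly the left side of the inequality in
    \<open>rip_slack_ok\<close>.\<close>
  also have "\<dots> < (1 - \<delta>s) * P"
    using ok P by (intro mult_strict_right_mono) (auto simp: rip_slack_ok_def R_def b_def \<alpha>_def)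
  finally show False by simp
qed

text \<open>The witness \<open>P\<close> is the \<open>q\<close>-th power of the Euclidean norm of
  \<open>v\<close> on \<open>S\<close> and the first block \<open>T\<close>. Both error bounds come
  from it: its control of the sum over \<open>S\<close> yields the \<open>q\<close>-norm estimate,
  its control of \<open>l2_norm v\<close> the Euclidean one.\<close>

lemma analysis_error_core:
  fixes v :: "real vec"
  assumes q: "0 < q" "q \<le> 1"
    and A: "A \<in> carrier_mat m n" and D: "D \<in> carrier_mat n d" and fr: "is_frame D L U"
    and h: "h \<in> carrier_vec n" and s: "0 < s" and a: "0 < a"
    and rip_a: "has_Eq_RIP A (canonical_dual D) q a \<delta>a"
    and rip_sa: "has_Eq_RIP A (canonical_dual D) q (s + a) \<delta>s"
    and ok: "rip_slack_ok \<delta>a \<delta>s (real s / real a) q L (U / L) t"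
    and S: "S \<subseteq> {..<d}" "card S \<le> s" and \<tau>: "0 \<le> \<tau>"
    and v_def: "v = transpose_mat D *\<^sub>v h"
    and cone: "(\<Sum>i\<in>{..<d} - S. \<bar>v $ i\<bar> powr q) \<le> (\<Sum>i\<in>S. \<bar>v $ i\<bar> powr q) + 2 * \<tau>"
    and N: "lq_norm q (A *\<^sub>v h) powr q \<le> N"
  obtains P where "0 \<le> P"
    "t * P \<le> 2 * real a powr (q / 2 - 1) * \<tau> + N"
    "(\<Sum>i\<in>S. \<bar>v $ i\<bar> powr q) \<le> real s powr (1 - q / 2) * P"
    "l2_norm v powr q \<le> (1 + (real s / real a) powr (1 - q / 2)) * P + 2 * real a powr (q / 2 - 1) * \<tau>"
proof -
  let ?E = "canonical_dual D"
  have E: "?E \<in> carrier_mat n d" using canonical_dual_carrier[OF D fr] .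
  have LU: "0 < L" "L \<le> U" using fr by (auto simp: is_frame_def)
  have v: "v \<in> carrier_vec d" using D h by (simp add: v_def)
  have Ev: "?E *\<^sub>v v = h" unfolding v_def using canonical_dual_reconstruct[OF D fr h] .
  have delta: "0 \<le> \<delta>a" "\<delta>s < 1" using rip_a rip_sa by (auto simp: has_Eq_RIP_def)
  have N0: "0 \<le> N" using N powr_ge_zero order_trans by blast
  define w where "w = restrict_vec v"
  define c where "c = (1 + \<delta>a) * L powr (- q / 2)"
  have c: "0 \<le> c" using delta by (simp add: c_def)
  have w_carrier: "w P \<in> carrier_vec d" for P using v by (simp add: w_def)
  have AE_carrier: "A *\<^sub>v (?E *\<^sub>v w P) \<in> carrier_vec m" for P
    using A E w_carrier[of P] by simp
  have AE_Un: "A *\<^sub>v (?E *\<^sub>v w (P \<union> Q)) = A *\<^sub>v (?E *\<^sub>v w P) + A *\<^sub>v (?E *\<^sub>v w Q)"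
    if "P \<inter> Q = {}" for P Q
  proof -
    have "w (P \<union> Q) = w P + w Q" unfolding w_def using that by (rule restrict_vec_Un)
    then have "?E *\<^sub>v w (P \<union> Q) = ?E *\<^sub>v w P + ?E *\<^sub>v w Q"
      using mult_add_distrib_mat_vec[OF E w_carrier w_carrier] by simp
    then show ?thesis
      using mult_add_distrib_mat_vec[OF A mult_mat_vec_carrier[OF E w_carrier]
          mult_mat_vec_carrier[OF E w_carrier]] by simp
  qed
  \<comment> \<open>The size of the image under \<open>A E\<close> of the part of \<open>v\<close>
    on \<open>P\<close>. It is subadditive on disjoint sets, and on sets of at most \<open>a\<close>
    indices the upper RIP bound and \<open>canonical_dual_bound\<close> control it, as
    \<open>tail_block_bound\<close> requires.\<close>
  define \<Phi> where "\<Phi> P = lq_norm q (A *\<^sub>v (?E *\<^sub>v w P)) powr q" for P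
  have \<Phi>_sub: "\<Phi> (P \<union> Q) \<le> \<Phi> P + \<Phi> Q" if "P \<inter> Q = {}" for P Q
    unfolding \<Phi>_def AE_Un[OF that]
    using AE_carrier[of P] AE_carrier[of Q] by (intro lq_norm_powr_add[OF q]) simp
  have \<Phi>_small: "\<Phi> P \<le> c * (\<Sum>i\<in>P. \<bar>v $ i\<bar>\<^sup>2) powr (q / 2)"
    if P: "finite P" "card P \<le> a" for P
  proof -
    have "\<Phi> P \<le> (1 + \<delta>a) * l2_norm (?E *\<^sub>v w P) powr q"
      using rip_a sparse_restrict_vec[OF P, of v] w_carrier[of P] E
      by (auto simp: has_Eq_RIP_def \<Phi>_def w_def)
    also have "\<dots> \<le> (1 + \<delta>a) * (l2_norm (w P) / sqrt L) powr q"
      using canonical_dual_bound[OF D fr w_carrier, of P] LU q delta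
      by (intro mult_left_mono powr_mono2) (auto simp: field_simps l2_norm_nonneg)
    also have "\<dots> = c * ((l2_norm (w P))\<^sup>2) powr (q / 2)"
      using LU l2_norm_nonneg[of "w P"]
      by (simp add: c_def powr_divide powr_half_sqrt[symmetric] powr_powr powr_minus_divide
          flip: powr_numeral)
    also have "\<dots> \<le> c * (\<Sum>i\<in>P. \<bar>v $ i\<bar>\<^sup>2) powr (q / 2)"
      unfolding w_def l2_norm_sq_restrict_vec power2_abs using P c q
      by (intro mult_left_mono powr_mono2 sum_mono2 sum_nonneg) auto
    finally show ?thesis .
  qed
  define I where "I = {..<d} - S"
  have finI: "finite I" and finS: "finite S"
    using S finite_subset by (auto simp: I_def)
  obtain T where T: "T \<subseteq> I" "card T = min a (card I)" "\<forall>i\<in>T. \<forall>j\<in>I - T. \<bar>v $ j\<bar> \<le> \<bar>v $ i\<bar>"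
    using exists_top_subset[OF finI, of "min a (card I)" "\<lambda>i. \<bar>v $ i\<bar>"] by auto
  have finT: "finite T" by (rule finite_subset[OF T(1) finI])
  define X where "X = l2_norm (w (S \<union> T))"
  define Y where "Y = l2_norm (w (I - T))"
  have XY0: "0 \<le> X" "0 \<le> Y" by (simp_all add: X_def Y_def l2_norm_nonneg)
  have X_sq: "X\<^sup>2 = (\<Sum>i\<in>S \<union> T. (v $ i)\<^sup>2)"
    using S T v unfolding X_def w_def l2_norm_sq_restrict_vec
    by (intro sum.cong) (auto simp: I_def)
  have Y_sq: "Y\<^sup>2 = (\<Sum>i\<in>I - T. \<bar>v $ i\<bar>\<^sup>2)"
    using v unfolding Y_def w_def l2_norm_sq_restrict_vec power2_abs
    by (intro sum.cong) (auto simp: I_def)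
  have part: "(S \<union> T) \<union> (I - T) = {..<d}" "(S \<union> T) \<inter> (I - T) = {}"
    using S T by (auto simp: I_def)
  have v_sq: "(l2_norm v)\<^sup>2 = X\<^sup>2 + Y\<^sup>2"
    using sum.union_disjoint[of "S \<union> T" "I - T" "\<lambda>i. (v $ i)\<^sup>2"] part finS finT finI v
    unfolding X_sq Y_sq l2_norm_sq[of v] by simp
  define \<alpha> where "\<alpha> = (real s / real a) powr (1 - q / 2)"
  define G where "G = 2 * real a powr (q / 2 - 1) * \<tau>"
  have G0: "0 \<le> G" using \<tau> by (simp add: G_def)
  have \<alpha>_eq: "real a powr (q / 2 - 1) * real s powr (1 - q / 2) = \<alpha>"
    using powr_minus_divide[of "real a" "1 - q / 2"] by (simp add: \<alpha>_def powr_divide)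
  have head: "(\<Sum>i\<in>S. \<bar>v $ i\<bar> powr q) \<le> real s powr (1 - q / 2) * X powr q"
  proof -
    have "(\<Sum>i\<in>S. \<bar>v $ i\<bar> powr q)
        \<le> real (card S) powr (1 - q / 2) * (\<Sum>i\<in>S. \<bar>v $ i\<bar> powr 2) powr (q / 2)"
      using finS q by (intro sum_powr_power_mean) auto
    also have "\<dots> \<le> real s powr (1 - q / 2) * (X\<^sup>2) powr (q / 2)"
      unfolding X_sq using q S finS finT
      by (intro mult_mono powr_mono2) (auto intro!: sum_nonneg sum_mono2)
    also have "(X\<^sup>2) powr (q / 2) = X powr q"
      using XY0 by (simp add: powr_powr flip: powr_numeral)
    finally show ?thesis .
  qed
  \<comment> \<open>The cone inequality passes from the complement of \<open>S\<close> to
    \<open>S\<close>, where \<open>head\<close> applies; the block scaling in \<open>a\<close> then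
    turns the power of \<open>s\<close> into one of the ratio.\<close>
  have tail: "real a powr (q / 2 - 1) * (\<Sum>i\<in>I. \<bar>v $ i\<bar> powr q) \<le> \<alpha> * X powr q + G"
  proof -
    have "(\<Sum>i\<in>I. \<bar>v $ i\<bar> powr q) \<le> real s powr (1 - q / 2) * X powr q + 2 * \<tau>"
      using cone head by (simp add: I_def)
    then have "real a powr (q / 2 - 1) * (\<Sum>i\<in>I. \<bar>v $ i\<bar> powr q)
        \<le> real a powr (q / 2 - 1) * (real s powr (1 - q / 2) * X powr q + 2 * \<tau>)"
      by (intro mult_left_mono) auto
    also have "\<dots> = \<alpha> * X powr q + G"
      unfolding \<alpha>_eq[symmetric] G_def by (simp add: algebra_simps)
    finally show ?thesis .
  qed
  have top: "\<And>i j. i \<in> T \<Longrightarrow> j \<in> I - T \<Longrightarrow> \<bar>v $ j\<bar> \<le> \<bar>v $ i\<bar>" using T(3) by blast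
  have "\<Phi> (I - T) \<le> c * (real a powr (q / 2 - 1) * (\<Sum>i\<in>I. \<bar>v $ i\<bar> powr q))"
    by (rule tail_block_bound[where w = "\<lambda>i. \<bar>v $ i\<bar>"])
      (use finI a q c \<Phi>_sub \<Phi>_small T top in auto)
  then have \<Phi>_tail: "\<Phi> (I - T) \<le> c * (\<alpha> * X powr q + G)"
    using mult_left_mono[OF tail c] by linarith
  \<comment> \<open>The same block bound is applied a second time, with the \<open>q\<close>-th
    power of the Euclidean norm in place of \<Phi> and constant 1, to control
    \<open>Y\<close>.\<close>
  have sub2: "(\<Sum>i\<in>P \<union> Q. \<bar>v $ i\<bar>\<^sup>2) powr (q / 2)
      \<le> (\<Sum>i\<in>P. \<bar>v $ i\<bar>\<^sup>2) powr (q / 2) + (\<Sum>i\<in>Q. \<bar>v $ i\<bar>\<^sup>2) powr (q / 2)"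
    if "P \<inter> Q = {}" "finite P" "finite Q" for P Q
    unfolding sum.union_disjoint[OF that(2,3,1)]
    using q by (intro powr_add_le_add_powr sum_nonneg) auto
  have "(\<Sum>i\<in>I - T. \<bar>v $ i\<bar>\<^sup>2) powr (q / 2) \<le> 1 * (real a powr (q / 2 - 1) * (\<Sum>i\<in>I. \<bar>v $ i\<bar> powr q))"
    by (rule tail_block_bound[where w = "\<lambda>i. \<bar>v $ i\<bar>"])
      (use finI a q sub2 T top in auto)
  moreover have "(Y\<^sup>2) powr (q / 2) = Y powr q" "(X\<^sup>2) powr (q / 2) = X powr q"
    using XY0 by (simp_all add: powr_powr flip: powr_numeral)
  ultimately have Y_le: "Y powr q \<le> \<alpha> * X powr q + G"
    using tail by (simp add: Y_sq)
  define e where "e = l2_norm (?E *\<^sub>v w (S \<union> T))"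
  \<comment> \<open>The lower RIP bound of order \<open>s + a\<close> applies on
    \<open>S \<union> T\<close>. As \<open>h = E v\<close>, the image there is \<open>A h\<close>
    minus the image of the tail, so noise and \<open>\<Phi>_tail\<close> bound it.\<close>
  have rip: "(1 - \<delta>s) * e powr q \<le> c * (\<alpha> * X powr q + G) + N"
  proof -
    have "card (S \<union> T) \<le> s + a"
      using card_Un_le[of S T] S(2) T(2) by linarith
    then have "sparse_vec (s + a) (w (S \<union> T))"
      unfolding w_def using finS finT by (intro sparse_restrict_vec) auto
    then have "(1 - \<delta>s) * e powr q \<le> \<Phi> (S \<union> T)"
      using rip_sa w_carrier[of "S \<union> T"] E by (auto simp: has_Eq_RIP_def e_def \<Phi>_def)
    also have "w {..<d} = v" unfolding w_def using v by (intro eq_vecI) auto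
    then have "A *\<^sub>v h = A *\<^sub>v (?E *\<^sub>v w (S \<union> T)) + A *\<^sub>v (?E *\<^sub>v w (I - T))"
      using AE_Un[OF part(2)] Ev unfolding part(1) by simp
    then have "A *\<^sub>v (?E *\<^sub>v w (S \<union> T)) = A *\<^sub>v h - A *\<^sub>v (?E *\<^sub>v w (I - T))"
      using AE_carrier[of "S \<union> T"] AE_carrier[of "I - T"] by (intro eq_vecI) auto
    then have "\<Phi> (S \<union> T) \<le> lq_norm q (A *\<^sub>v h) powr q + \<Phi> (I - T)"
      unfolding \<Phi>_def using A by (simp add: lq_norm_powr_diff[OF q])
    finally show ?thesis using N \<Phi>_tail by linarith
  qed
  have "X\<^sup>2 = scalar_prod (w (S \<union> T)) v"
    by (simp add: X_def w_def scalar_prod_restrict_vec)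
  also have "\<dots> \<le> l2_norm (transpose_mat D *\<^sub>v (?E *\<^sub>v w (S \<union> T))) * l2_norm v"
    unfolding v_def using scalar_prod_analysis_le[OF D fr _ h] w_carrier v_def by simp
  also have "\<dots> \<le> (sqrt U * e) * l2_norm v"
    unfolding e_def using frame_bounds_sqrt(2)[OF D fr] mult_mat_vec_carrier[OF E w_carrier]
    by (intro mult_right_mono) (auto simp: l2_norm_nonneg)
  also have "l2_norm v = sqrt (X\<^sup>2 + Y\<^sup>2)"
    using v_sq l2_norm_nonneg[of v] by (metis real_sqrt_unique)
  \<comment> \<open>\<open>U\<close> is written as \<open>U / L * L\<close> to match
    \<open>\<kappa> * L\<close> in \<open>rip_slack_bound\<close>.\<close>
  finally have XW: "X\<^sup>2 \<le> sqrt (U / L * L) * e * sqrt (X\<^sup>2 + Y\<^sup>2)" using LU by simp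
  have e0: "0 \<le> e" by (simp add: e_def l2_norm_nonneg)
  have \<rho>: "0 < real s / real a" and \<kappa>: "1 \<le> U / L" using s a LU by auto
  have "t * X powr q \<le> G + N"
    by (rule rip_slack_bound[OF ok q(1) \<rho> LU(1) \<kappa> delta XY0 G0 N0 e0 _ XW])
      (use rip Y_le in \<open>auto simp: c_def \<alpha>_def\<close>)
  moreover have "l2_norm v powr q \<le> (1 + \<alpha>) * X powr q + G"
  proof -
    have "l2_norm v powr q = ((l2_norm v)\<^sup>2) powr (q / 2)"
      using l2_norm_nonneg[of v] by (simp add: powr_powr flip: powr_numeral)
    also have "\<dots> \<le> X powr q + Y powr q"
      unfolding v_sq using powr_add_le_add_powr[of "X\<^sup>2" "Y\<^sup>2" "q / 2"] q
        \<open>(Y\<^sup>2) powr (q / 2) = Y powr q\<close> \<open>(X\<^sup>2) powr (q / 2) = X powr q\<close> by simp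
    finally show ?thesis using Y_le by (simp add: algebra_simps)
  qed
  ultimately show ?thesis
    using that[of "X powr q"] head by (simp add: G_def \<alpha>_def)
qed

section \<open>From powers to the stated error bounds\<close>

text \<open>Used with exponent \<open>1 / q\<close>, where subadditivity may fail; bounding the sum
  by twice the maximum costs only a constant.\<close>

lemma powr_add_le_two_powr:
  fixes a b p :: real
  assumes "0 \<le> a" "0 \<le> b" "0 \<le> p"
  shows "(a + b) powr p \<le> 2 powr p * (a powr p + b powr p)"
proof -
  have "(a + b) powr p \<le> (2 * max a b) powr p" using assms by (intro powr_mono2) auto
  also have "\<dots> = 2 powr p * max a b powr p" using assms by (simp add: powr_mult)
  also have "\<dots> \<le> 2 powr p * (a powr p + b powr p)"
    by (intro mult_left_mono) (auto simp: max_def)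
  finally show ?thesis .
qed

text \<open>Takes the \<open>q\<close>-th root of a bound on powers. The 4 is the factor 2 already
  in both terms times the 2 lost in splitting the root of a sum.\<close>

lemma error_root_bound:
  fixes V K \<alpha> \<sigma> M \<epsilon> s q k :: real
  assumes q: "0 < q" and K: "0 \<le> K" and \<alpha>: "0 \<le> \<alpha>" and s: "0 < s"
    and nn: "0 \<le> V" "0 \<le> \<sigma>" "0 \<le> M" "0 \<le> \<epsilon>"
    and le: "V powr q \<le> K * (2 * \<alpha> * s powr (q / 2 - 1) * \<sigma> powr q + 2 * M powr (1 - q * k) * \<epsilon> powr q)"
  shows "V \<le> (4 * K * \<alpha>) powr (1 / q) * \<sigma> / s powr (1 / q - 1 / 2)
    + (4 * K) powr (1 / q) * M powr (1 / q - k) * \<epsilon>"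
proof -
  define G where "G = 2 * \<alpha> * s powr (q / 2 - 1) * \<sigma> powr q"
  define N where "N = 2 * M powr (1 - q * k) * \<epsilon> powr q"
  have GN: "0 \<le> G" "0 \<le> N" using \<alpha> by (simp_all add: G_def N_def)
  have "V = (V powr q) powr (1 / q)" using q nn by (simp add: powr_powr)
  also have "\<dots> \<le> (K * (G + N)) powr (1 / q)"
    using le q unfolding G_def N_def by (intro powr_mono2) auto
  also have "\<dots> = K powr (1 / q) * (G + N) powr (1 / q)"
    using K GN by (simp add: powr_mult)
  also have "\<dots> \<le> K powr (1 / q) * (2 powr (1 / q) * (G powr (1 / q) + N powr (1 / q)))"
    using GN q by (intro mult_left_mono powr_add_le_two_powr) auto
  also have "G powr (1 / q) = 2 powr (1 / q) * \<alpha> powr (1 / q) * s powr (1 / 2 - 1 / q) * \<sigma>"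
  proof -
    have "(q / 2 - 1) * (1 / q) = 1 / 2 - 1 / q" using q by (simp add: field_simps)
    then show ?thesis using q nn \<alpha> by (simp add: G_def powr_mult powr_powr)
  qed
  also have "N powr (1 / q) = 2 powr (1 / q) * M powr (1 / q - k) * \<epsilon>"
  proof -
    have "(1 - q * k) * (1 / q) = 1 / q - k" using q by (simp add: field_simps)
    then show ?thesis using q nn by (simp add: N_def powr_mult powr_powr)
  qed
  also have "s powr (1 / 2 - 1 / q) = 1 / s powr (1 / q - 1 / 2)"
    using powr_minus_divide[of s "1 / q - 1 / 2"] by simp
  also have "K powr (1 / q) * (2 powr (1 / q) * (2 powr (1 / q) * \<alpha> powr (1 / q) *
      (1 / s powr (1 / q - 1 / 2)) * \<sigma> + 2 powr (1 / q) * M powr (1 / q - k) * \<epsilon>))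
    = (2 powr (1 / q) * 2 powr (1 / q) * K powr (1 / q) * \<alpha> powr (1 / q)) * \<sigma> / s powr (1 / q - 1 / 2)
      + (2 powr (1 / q) * 2 powr (1 / q) * K powr (1 / q)) * M powr (1 / q - k) * \<epsilon>"
    by (simp add: algebra_simps)
  also have "2 powr (1 / q) * 2 powr (1 / q) = (4::real) powr (1 / q)"
    by (simp flip: powr_mult)
  finally show ?thesis using K \<alpha> by (simp add: powr_mult)
qed

lemma lr_norm_uminus: "lr_norm r (- z) = lr_norm r z"
proof -
  have "(\<lambda>j. \<bar>(- z) $ j\<bar>) ` {..<dim_vec z} = (\<lambda>j. \<bar>z $ j\<bar>) ` {..<dim_vec z}"
    by (intro image_cong) auto
  then show ?thesis by (simp add: lr_norm_def linf_norm_def lq_norm_def)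
qed

text \<open>The signal \<open>f\<close> is feasible because its residual is \<open>- z\<close>, so
  minimality of \<open>fh\<close> supplies the hypothesis of \<open>cone_constraint\<close>. The
  second bound adds the residual of \<open>fh\<close> and the noise \<open>z\<close>, each within
  \<epsilon>.\<close>

lemma analysis_solution_cone:
  assumes q: "0 < q" "q \<le> 1" and r: "1 \<le> r" and e: "0 \<le> \<epsilon>"
    and A: "A \<in> carrier_mat m n" and f: "f \<in> carrier_vec n" and z: "z \<in> carrier_vec m"
    and le: "lr_norm r z \<le> \<epsilon>" and y: "y = A *\<^sub>v f + z" and D: "D \<in> carrier_mat n d"
    and sol: "is_lq_analysis_solution D A y q r \<epsilon> fh"
    and S: "S \<subseteq> {..<d}"
  shows "(\<Sum>i\<in>{..<d} - S. \<bar>(transpose_mat D *\<^sub>v (fh - f)) $ i\<bar> powr q)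
      \<le> (\<Sum>i\<in>S. \<bar>(transpose_mat D *\<^sub>v (fh - f)) $ i\<bar> powr q)
        + 2 * (\<Sum>i\<in>{..<d} - S. \<bar>(transpose_mat D *\<^sub>v f) $ i\<bar> powr q)" (is ?cone)
    and "lq_norm q (A *\<^sub>v (fh - f)) powr q \<le> 2 * real m powr (1 - q * recip_ereal r) * \<epsilon> powr q"
proof -
  let ?T = "transpose_mat D"
  have fh: "fh \<in> carrier_vec n" and feas: "lr_norm r (A *\<^sub>v fh - y) \<le> \<epsilon>"
    and min: "\<And>g. g \<in> carrier_vec n \<Longrightarrow> lr_norm r (A *\<^sub>v g - y) \<le> \<epsilon> \<Longrightarrow>
      lq_norm q (?T *\<^sub>v fh) \<le> lq_norm q (?T *\<^sub>v g)"
    using sol A by (auto simp: is_lq_analysis_solution_def)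
  have T: "?T \<in> carrier_mat d n" using D by simp
  have Af: "A *\<^sub>v f \<in> carrier_vec m" and Afh: "A *\<^sub>v fh \<in> carrier_vec m" using A f fh by auto
  have "A *\<^sub>v f - y = - z" unfolding y using Af z by (intro eq_vecI) auto
  then have "lq_norm q (?T *\<^sub>v fh) \<le> lq_norm q (?T *\<^sub>v f)"
    using min[OF f] le by (simp add: lr_norm_uminus)
  then have "lq_norm q (?T *\<^sub>v fh) powr q \<le> lq_norm q (?T *\<^sub>v f) powr q"
    using q by (intro powr_mono2) (auto simp: lq_norm_def)
  moreover have "(?T *\<^sub>v fh) $ i = (?T *\<^sub>v f) $ i + (?T *\<^sub>v (fh - f)) $ i" if "i < d" for i
    unfolding mult_minus_distrib_mat_vec[OF T fh f] using that D by simp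
  ultimately have "(\<Sum>i<d. \<bar>(?T *\<^sub>v f) $ i + (?T *\<^sub>v (fh - f)) $ i\<bar> powr q)
      \<le> (\<Sum>i<d. \<bar>(?T *\<^sub>v f) $ i\<bar> powr q)"
    using D q by (simp add: lq_norm_powr del: index_mult_mat_vec)
  then show ?cone by (rule cone_constraint[OF q finite_lessThan S])
  have "u - w = (u - (w + z)) + z" if "u \<in> carrier_vec m" "w \<in> carrier_vec m" for u w
    using that z by (intro eq_vecI) auto
  from this[OF Afh Af] have "A *\<^sub>v (fh - f) = (A *\<^sub>v fh - y) + z"
    unfolding mult_minus_distrib_mat_vec[OF A fh f] y .
  then have "lq_norm q (A *\<^sub>v (fh - f)) powr q
      \<le> lq_norm q (A *\<^sub>v fh - y) powr q + lq_norm q z powr q"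
    using lq_norm_powr_add[OF q, of "A *\<^sub>v fh - y" z] z y by simp
  also have "\<dots> \<le> real m powr (1 - q * recip_ereal r) * \<epsilon> powr q
      + real m powr (1 - q * recip_ereal r) * \<epsilon> powr q"
    using Af Afh z y le feas e
    by (intro add_mono lq_norm_powr_le_lr_norm[OF q r]) auto
  finally show "lq_norm q (A *\<^sub>v (fh - f)) powr q
      \<le> 2 * real m powr (1 - q * recip_ereal r) * \<epsilon> powr q" by (simp add: mult_ac)
qed

text \<open>\<open>K\<close> arises from inserting \<open>P \<le> (G + N) / t\<close> into the core
  bound on \<open>l2_norm v\<close>, its summand 1 absorbing the remaining \<open>G\<close>.
  Dividing by \<open>sqrt L\<close> passes from \<open>D\<^sup>T h\<close> to
  \<open>h\<close>.\<close>

lemma analysis_error_bounds: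
  assumes q: "0 < q" "q \<le> 1" and r: "1 \<le> r" and e: "0 \<le> \<epsilon>"
    and A: "A \<in> carrier_mat m n" and f: "f \<in> carrier_vec n" and z: "z \<in> carrier_vec m"
    and le: "lr_norm r z \<le> \<epsilon>" and y: "y = A *\<^sub>v f + z" and D: "D \<in> carrier_mat n d"
    and fr: "is_frame D L U" and s: "0 < s" and a: "s < a"
    and rip_a: "has_Eq_RIP A (canonical_dual D) q a \<delta>a"
    and rip_sa: "has_Eq_RIP A (canonical_dual D) q (s + a) \<delta>s"
    and ok: "rip_slack_ok \<delta>a \<delta>s (real s / real a) q L (U / L) t"
    and sol: "is_lq_analysis_solution D A y q r \<epsilon> fh"
    and \<alpha>_def: "\<alpha> = (real s / real a) powr (1 - q / 2)"
    and K_def: "K = (1 + \<alpha>) / t + 1"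
    and \<sigma>_def: "\<sigma> = lq_norm q (transpose_mat D *\<^sub>v f - best_s_term s (transpose_mat D *\<^sub>v f))"
  shows "l2_norm (fh - f) \<le> (4 * K * \<alpha>) powr (1 / q) / sqrt L * \<sigma> / real s powr (1 / q - 1 / 2)
      + (4 * K) powr (1 / q) / sqrt L * real m powr (1 / q - recip_ereal r) * \<epsilon>"
    and "lq_norm q (transpose_mat D *\<^sub>v fh - transpose_mat D *\<^sub>v f) powr q
      \<le> (4 * \<alpha> / t + 2) * \<sigma> powr q
        + 4 / t * real a powr (1 - q / 2) * real m powr (1 - q * recip_ereal r) * \<epsilon> powr q"
proof -
  let ?T = "transpose_mat D"
  define x where "x = ?T *\<^sub>v f"
  define h where "h = fh - f"
  define v where "v = ?T *\<^sub>v h"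
  have fh: "fh \<in> carrier_vec n" using sol A by (auto simp: is_lq_analysis_solution_def)
  have h: "h \<in> carrier_vec n" using fh f by (simp add: h_def)
  have T: "?T \<in> carrier_mat d n" using D by simp
  have x: "dim_vec x = d" and v: "dim_vec v = d" using D by (simp_all add: x_def v_def)
  obtain S where S: "S \<subseteq> {..<d}" "card S \<le> s" "best_s_term s x = restrict_vec x S"
    using best_s_term_restrict[of x s] x by metis
  define \<tau> where "\<tau> = (\<Sum>i\<in>{..<d} - S. \<bar>x $ i\<bar> powr q)"
  have \<sigma>: "\<sigma> powr q = \<tau>"
    using lq_norm_powr_diff_restrict_vec[OF q(1), of S x] S x
    by (simp add: \<sigma>_def \<tau>_def x_def)
  have \<sigma>0: "0 \<le> \<sigma>" and \<tau>0: "0 \<le> \<tau>" by (simp_all add: \<sigma>_def lq_norm_def \<tau>_def sum_nonneg)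
  note sol' = analysis_solution_cone[OF q r e A f z le y D sol S(1),
      folded x_def h_def, folded v_def, folded \<tau>_def]
  define N where "N = 2 * real m powr (1 - q * recip_ereal r) * \<epsilon> powr q"
  define G where "G = 2 * real a powr (q / 2 - 1) * \<tau>"
  have a0: "0 < a" using s a by simp
  obtain P where P: "0 \<le> P" "t * P \<le> G + N"
    "(\<Sum>i\<in>S. \<bar>v $ i\<bar> powr q) \<le> real s powr (1 - q / 2) * P"
    "l2_norm v powr q \<le> (1 + \<alpha>) * P + G"
    using analysis_error_core[OF q A D fr h s a0 rip_a rip_sa ok S(1,2) \<tau>0 v_def sol'(1)
        sol'(2)[folded N_def]]
    unfolding \<alpha>_def G_def by metis
  have t: "0 < t" using ok by (simp add: rip_slack_ok_def)
  have L: "0 < L" using fr by (simp add: is_frame_def)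
  have \<alpha>: "0 < \<alpha>" using s a0 by (simp add: \<alpha>_def)
  have K: "0 < K" using \<alpha> t by (simp add: K_def add_pos_pos)
  have N0: "0 \<le> N" by (simp add: N_def)
  have P_le: "P \<le> (G + N) / t" using P(2) t by (simp add: field_simps)
  \<comment> \<open>Trades the block scaling in \<open>a\<close> for the scaling in \<open>s\<close>
    that the Euclidean estimate asks for.\<close>
  have sa: "real a powr (q / 2 - 1) = \<alpha> * real s powr (q / 2 - 1)"
    using powr_minus_divide[of "real a" "1 - q / 2"] powr_minus_divide[of "real s" "1 - q / 2"] s
    by (simp add: \<alpha>_def powr_divide)
  have "l2_norm v powr q \<le> (1 + \<alpha>) * ((G + N) / t) + (G + N)"
    using P(4) mult_left_mono[OF P_le, of "1 + \<alpha>"] \<alpha> N0 by linarith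
  also have "\<dots> = K * (G + N)" by (simp add: K_def algebra_simps add_divide_distrib)
  finally have "l2_norm v powr q \<le> K * (2 * \<alpha> * real s powr (q / 2 - 1) * \<sigma> powr q
      + 2 * real m powr (1 - q * recip_ereal r) * \<epsilon> powr q)"
    by (simp add: G_def N_def sa \<sigma> algebra_simps)
  then have "l2_norm v \<le> (4 * K * \<alpha>) powr (1 / q) * \<sigma> / real s powr (1 / q - 1 / 2)
    + (4 * K) powr (1 / q) * real m powr (1 / q - recip_ereal r) * \<epsilon>"
    using K \<alpha> s \<sigma>0 e l2_norm_nonneg by (intro error_root_bound[OF q(1)]) auto
  then have "sqrt L * l2_norm h \<le> (4 * K * \<alpha>) powr (1 / q) * \<sigma> / real s powr (1 / q - 1 / 2)
    + (4 * K) powr (1 / q) * real m powr (1 / q - recip_ereal r) * \<epsilon>"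
    using frame_bounds_sqrt(1)[OF D fr h] by (simp add: v_def)
  then have "l2_norm h \<le> ((4 * K * \<alpha>) powr (1 / q) * \<sigma> / real s powr (1 / q - 1 / 2)
    + (4 * K) powr (1 / q) * real m powr (1 / q - recip_ereal r) * \<epsilon>) / sqrt L"
    using L by (simp add: pos_le_divide_eq mult.commute)
  then show "l2_norm (fh - f) \<le> (4 * K * \<alpha>) powr (1 / q) / sqrt L * \<sigma> / real s powr (1 / q - 1 / 2)
      + (4 * K) powr (1 / q) / sqrt L * real m powr (1 / q - recip_ereal r) * \<epsilon>"
    by (simp add: h_def add_divide_distrib mult.commute)
  have "?T *\<^sub>v fh - ?T *\<^sub>v f = v"
    unfolding v_def h_def mult_minus_distrib_mat_vec[OF T fh f] ..
  then have "lq_norm q (?T *\<^sub>v fh - ?T *\<^sub>v f) powr q = (\<Sum>i<d. \<bar>v $ i\<bar> powr q)"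
    using q v by (simp add: lq_norm_powr)
  also have "\<dots> = (\<Sum>i\<in>{..<d} - S. \<bar>v $ i\<bar> powr q) + (\<Sum>i\<in>S. \<bar>v $ i\<bar> powr q)"
    by (rule sum.subset_diff[OF S(1) finite_lessThan])
  \<comment> \<open>By the cone inequality the sum off \<open>S\<close> costs another copy of the
    sum on \<open>S\<close>, hence the first 2.\<close>
  also have "\<dots> \<le> 2 * (real s powr (1 - q / 2) * P) + 2 * \<tau>"
    using sol'(1) P(3) by linarith
  also have "\<dots> \<le> 2 * (real s powr (1 - q / 2) * ((G + N) / t)) + 2 * \<tau>"
    using P_le by (intro add_mono mult_left_mono) auto
  also have "\<dots> = 2 / t * (real s powr (1 - q / 2) * G) + 2 * \<tau> + 2 / t * (real s powr (1 - q / 2) * N)"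
    using t by (simp add: field_simps)
  also have "real s powr (1 - q / 2) * G = 2 * \<alpha> * \<tau>"
    using powr_minus_divide[of "real s" "1 - q / 2"] s by (simp add: G_def sa)
  \<comment> \<open>Since \<open>s < a\<close> and the exponent is positive, \<open>s\<close> may be
    enlarged to \<open>a\<close> in the noise term.\<close>
  also have "2 / t * (real s powr (1 - q / 2) * N) \<le> 2 / t * (real a powr (1 - q / 2) * N)"
    using N0 q a t by (intro mult_left_mono mult_right_mono powr_mono2) auto
  finally show "lq_norm q (?T *\<^sub>v fh - ?T *\<^sub>v f) powr q
      \<le> (4 * \<alpha> / t + 2) * \<sigma> powr q
        + 4 / t * real a powr (1 - q / 2) * real m powr (1 - q * recip_ereal r) * \<epsilon> powr q"
    by (simp add: N_def \<sigma> algebra_simps)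
qed

text \<open>Choosing \<open>t\<close> from the six parameters alone makes the final constants
  independent of the matrices, the signal and the noise. The value is meaningful where an admissible
  slack exists.\<close>

definition rip_slack :: "real \<Rightarrow> real \<Rightarrow> real \<Rightarrow> real \<Rightarrow> real \<Rightarrow> real \<Rightarrow> real" where
  "rip_slack \<delta>a \<delta>s \<rho> q L \<kappa> = (SOME t. rip_slack_ok \<delta>a \<delta>s \<rho> q L \<kappa> t)"

definition error_factor :: "real \<Rightarrow> real \<Rightarrow> real \<Rightarrow> real \<Rightarrow> real \<Rightarrow> real \<Rightarrow> real" where
  "error_factor \<delta>a \<delta>s \<rho> q L \<kappa> = (1 + \<rho> powr (1 - q / 2)) / rip_slack \<delta>a \<delta>s \<rho> q L \<kappa> + 1"

theorem theorem2p1: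
  shows "\<exists>C1 C2 C3 C4 :: real \<Rightarrow> real \<Rightarrow> real \<Rightarrow> real \<Rightarrow> real \<Rightarrow> real \<Rightarrow> real.
    \<forall>(q::real) (r::ereal) (\<epsilon>::real) (m::nat) (n::nat) (d::nat) (A::real mat) (f::real vec)
      (z::real vec) (y::real vec) (D::real mat) (L::real) (U::real) (s::nat) (a::nat)
      (\<delta>a::real) (\<delta>sa::real) (fh::real vec).
      0 < q \<and> q \<le> 1 \<and> 1 \<le> r \<and> 0 \<le> \<epsilon> \<and>
      A \<in> carrier_mat m n \<and> f \<in> carrier_vec n \<and> z \<in> carrier_vec m \<and>
      lr_norm r z \<le> \<epsilon> \<and> y = A *\<^sub>v f + z \<and>
      D \<in> carrier_mat n d \<and> is_frame D L U \<and>
      0 < s \<and> s < a \<and>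
      is_Eq_RIP_const A (canonical_dual D) q a \<delta>a \<and>
      is_Eq_RIP_const A (canonical_dual D) q (s + a) \<delta>sa \<and>
      (real s / real a) powr (1 - q / 2) * ((real s / real a) powr (2 / q - 1) + 1) powr (q / 2)
        * (U / L) powr q * (1 + \<delta>a) < 1 - \<delta>sa \<and>
      is_lq_analysis_solution D A y q r \<epsilon> fh
    \<longrightarrow>
      (let \<rho> = real s / real a; \<kappa> = U / L;
           x = transpose_mat D *\<^sub>v f; \<sigma> = lq_norm q (x - best_s_term s x) in
       0 < C1 \<delta>a \<delta>sa \<rho> q L \<kappa> \<and> 0 < C2 \<delta>a \<delta>sa \<rho> q L \<kappa> \<and>
       0 < C3 \<delta>a \<delta>sa \<rho> q L \<kappa> \<and> 0 < C4 \<delta>a \<delta>sa \<rho> q L \<kappa> \<and>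
       l2_norm (fh - f) \<le> C1 \<delta>a \<delta>sa \<rho> q L \<kappa> * \<sigma> / real s powr (1 / q - 1 / 2)
          + C2 \<delta>a \<delta>sa \<rho> q L \<kappa> * real m powr (1 / q - recip_ereal r) * \<epsilon> \<and>
       (lq_norm q (transpose_mat D *\<^sub>v fh - x)) powr q \<le> C3 \<delta>a \<delta>sa \<rho> q L \<kappa> * \<sigma> powr q
          + C4 \<delta>a \<delta>sa \<rho> q L \<kappa> * real a powr (1 - q / 2)
            * real m powr (1 - q * recip_ereal r) * \<epsilon> powr q)"
proof (intro exI allI impI, elim conjE, unfold Let_def)
  fix q :: real and r :: ereal and \<epsilon> :: real and m n d :: nat and A :: "real mat"
    and f z y :: "real vec" and D :: "real mat" and L U :: real and s a :: nat
    and \<delta>a \<delta>sa :: real and fh :: "real vec"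
  assume q: "0 < q" "q \<le> 1" and r: "1 \<le> r" and e: "0 \<le> \<epsilon>"
    and A: "A \<in> carrier_mat m n" and f: "f \<in> carrier_vec n" and z: "z \<in> carrier_vec m"
    and le: "lr_norm r z \<le> \<epsilon>" and y: "y = A *\<^sub>v f + z" and D: "D \<in> carrier_mat n d"
    and fr: "is_frame D L U" and s: "0 < s" and a: "s < a"
    and "is_Eq_RIP_const A (canonical_dual D) q a \<delta>a"
    and "is_Eq_RIP_const A (canonical_dual D) q (s + a) \<delta>sa"
    and cond: "(real s / real a) powr (1 - q / 2) * ((real s / real a) powr (2 / q - 1) + 1) powr (q / 2)
        * (U / L) powr q * (1 + \<delta>a) < 1 - \<delta>sa"
    and sol: "is_lq_analysis_solution D A y q r \<epsilon> fh"
  then have rip: "has_Eq_RIP A (canonical_dual D) q a \<delta>a"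
    "has_Eq_RIP A (canonical_dual D) q (s + a) \<delta>sa"
    by (simp_all add: is_Eq_RIP_const_def)
  let ?\<rho> = "real s / real a" and ?\<kappa> = "U / L"
  let ?t = "rip_slack \<delta>a \<delta>sa ?\<rho> q L ?\<kappa>" and ?K = "error_factor \<delta>a \<delta>sa ?\<rho> q L ?\<kappa>"
  let ?\<alpha> = "?\<rho> powr (1 - q / 2)"
  \<comment> \<open>Existential introduction left the four witnesses schematic. These functions,
    read off from \<open>analysis_error_bounds\<close>, instantiate them in the final
    \<open>show\<close>.\<close>
  let ?C1 = "\<lambda>\<delta>a \<delta>s \<rho> q L \<kappa>. (4 * error_factor \<delta>a \<delta>s \<rho> q L \<kappa> * \<rho> powr (1 - q / 2)) powr (1 / q) / sqrt L"
  let ?C2 = "\<lambda>\<delta>a \<delta>s \<rho> q L \<kappa>. (4 * error_factor \<delta>a \<delta>s \<rho> q L \<kappa>) powr (1 / q) / sqrt L"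
  let ?C3 = "\<lambda>\<delta>a \<delta>s \<rho> q L \<kappa>. 4 * \<rho> powr (1 - q / 2) / rip_slack \<delta>a \<delta>s \<rho> q L \<kappa> + 2"
  let ?C4 = "\<lambda>\<delta>a \<delta>s \<rho> q L \<kappa>. 4 / rip_slack \<delta>a \<delta>s \<rho> q L \<kappa>"
  let ?x = "transpose_mat D *\<^sub>v f"
  let ?\<sigma> = "lq_norm q (?x - best_s_term s ?x)"
  have L: "0 < L" "1 \<le> ?\<kappa>" using fr by (auto simp: is_frame_def)
  have \<rho>: "0 < ?\<rho>" using s a by simp
  have "0 \<le> \<delta>a" using rip by (simp add: has_Eq_RIP_def)
  from rip_slack_ok_exists[OF q(1) \<rho> L this cond]
  have ok: "rip_slack_ok \<delta>a \<delta>sa ?\<rho> q L ?\<kappa> ?t"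
    unfolding rip_slack_def by (rule someI_ex)
  have t: "0 < ?t" using ok by (simp add: rip_slack_ok_def)
  have \<alpha>: "0 < ?\<alpha>" using s a by simp
  have K: "0 < ?K" using t \<alpha> unfolding error_factor_def by (intro add_pos_pos divide_pos_pos) auto
  note bounds = analysis_error_bounds[OF q r e A f z le y D fr s a rip ok sol refl
      error_factor_def refl]
  have "0 < ?C1 \<delta>a \<delta>sa ?\<rho> q L ?\<kappa>" using K \<alpha> L by simp
  moreover have "0 < ?C2 \<delta>a \<delta>sa ?\<rho> q L ?\<kappa>" using K L by simp
  moreover have "0 < ?C3 \<delta>a \<delta>sa ?\<rho> q L ?\<kappa>"
    using t \<alpha> by (intro add_pos_pos divide_pos_pos) auto
  moreover have "0 < ?C4 \<delta>a \<delta>sa ?\<rho> q L ?\<kappa>" using t by simp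
  ultimately show "0 < ?C1 \<delta>a \<delta>sa ?\<rho> q L ?\<kappa> \<and> 0 < ?C2 \<delta>a \<delta>sa ?\<rho> q L ?\<kappa> \<and>
       0 < ?C3 \<delta>a \<delta>sa ?\<rho> q L ?\<kappa> \<and> 0 < ?C4 \<delta>a \<delta>sa ?\<rho> q L ?\<kappa> \<and>
       l2_norm (fh - f) \<le> ?C1 \<delta>a \<delta>sa ?\<rho> q L ?\<kappa> * ?\<sigma> / real s powr (1 / q - 1 / 2)
          + ?C2 \<delta>a \<delta>sa ?\<rho> q L ?\<kappa> * real m powr (1 / q - recip_ereal r) * \<epsilon> \<and>
       (lq_norm q (transpose_mat D *\<^sub>v fh - ?x)) powr q \<le> ?C3 \<delta>a \<delta>sa ?\<rho> q L ?\<kappa> * ?\<sigma> powr q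
          + ?C4 \<delta>a \<delta>sa ?\<rho> q L ?\<kappa> * real a powr (1 - q / 2)
            * real m powr (1 - q * recip_ereal r) * \<epsilon> powr q"
    using bounds by blast
qed

end
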